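(* Consider the problem of minimizing $f(x)=\mathbb{E}[F(x;\omega)]$ over $x\in\mathcal{X}$, and let $x^*$ be a sharp (local) minimum of $f$. Suppose that: (i) $F(x;\omega)$ is continuously differentiable in $x$ for almost all $\omega\in\Omega$; (ii) there is a finite $V\ge 0$ with $\mathbb{E}[\|\nabla F(x;\omega)\|_*^2]\le V^2$ for all $x\in\mathcal{X}$; (iii) for every $p\in\mathcal{X}$ and every sequence $y_n\in\mathcal{Y}$, $\Phi(p,y_n)\to 0$ whenever $Q(y_n)\to p$. Suppose further that stochastic mirror descent is run with a surjective mirror map $Q:\mathcal{Y}\to\mathcal{X}$. Then there exists an open neighborhood $\mathcal{U}$ of $x^*$ such that, for every confidence level $\delta>0$ (with $\mathcal{U}$ independent of $\delta$), the iterates $X_n$ satisfy $$\mathbb{P}(X_n=x^*\text{ for all sufficiently large }n\mid X_1\in\mathcal{U})\ge 1-\delta$$ provided that the step-size sequence $\gamma_n$ is small enough, in the sense that $\sum_{n=1}^\infty\gamma_n^2\le\eta$ for a suitable threshold $\eta=\eta(\delta)>0$.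
   Context: $\mathcal{X}$ is a nonempty compact convex subset of a finite-dimensional real vector space $\mathcal{V}$ with norm $\|\cdot\|$; $\mathcal{Y}=\mathcal{V}^*$ is the dual space, $\langle y,x\rangle$ the duality pairing, and $\|y\|_*=\sup\{\langle y,x\rangle:\|x\|\le 1\}$ the dual norm. $(\Omega,\mathcal{F},\mathbb{P})$ is a complete probability space, $F:\mathcal{X}\times\Omega\to\mathbb{R}$ is a stochastic objective, and $f(x)=\mathbb{E}[F(x;\omega)]$. Gradients are taken with respect to $x$ and are elements of $\mathcal{Y}$. Under hypotheses (i) and (ii), $f$ is continuously differentiable with $\nabla f(x)=\mathbb{E}[\nabla F(x;\omega)]$. Neighborhoods are relative to $\mathcal{X}$. Sharp minimum: $x^*\in\mathcal{X}$ is a sharp (local) minimum of $f$ if there is $\rho>0$ such that $f(x)\ge f(x^* )+\rho\|x-x^*\|$ for all $x\in\mathcal{X}$ sufficiently close to $x^*$. Mirror map: $h:\mathcal{X}\to\mathbb{R}$ is a regularizer, i.e. continuous and $K$-strongly convex for some $K>0$: $h(\tau x+(1-\tau)x')\le\tau h(x)+(1-\tau)h(x')-\tfrac12K\tau(1-\tau)\|x'-x\|^2$ for all $x,x'\in\mathcal{X}$, $\tau\in[0,1]$. The induced mirror map is $Q:\mathcal{Y}\to\mathcal{X}$, $Q(y)=\arg\max_{x\in\mathcal{X}}\{\langle y,x\rangle-h(x)\}$. The Fenchel coupling is $\Phi(p,y)=h(p)+h^*(y)-\langle y,p\rangle$ for $p\in\mathcal{X}$, $y\in\mathcal{Y}$,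 where $h^*(y)=\max_{x\in\mathcal{X}}\{\langle y,x\rangle-h(x)\}$. Stochastic mirror descent (SMD): $X_n=Q(Y_n)$, $Y_{n+1}=Y_n-\gamma_n\nabla F(X_n;\omega_n)$, $n=1,2,\dots$, with deterministic initialization $Y_1\in\mathcal{Y}$ (so conditioning on $X_1\in\mathcal{U}$ means that $Y_1$ is such that $Q(Y_1)\in\mathcal{U}$), $\omega_n$ i.i.d. samples distributed according to $\mathbb{P}$, and step-sizes $\gamma_n>0$ satisfying $\sum_n\gamma_n^2<\infty$ and $\sum_n\gamma_n=\infty$. *)

theory Defs
  imports "HOL-Probability.Probability"
begin

text \<open>
  The primal space is a type \<open>'v\<close> of class \<open>real_normed_vector\<close> that is assumed to be
  finite-dimensional.  Its dual is the type of bounded linear functionals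
  \<open>'v \<Rightarrow>\<^sub>L real\<close>: in finite dimension these are all the linear functionals, the
  duality pairing is application, and the norm of that type is the dual norm.
\<close>

definition finite_dimensional :: "'v::real_vector itself \<Rightarrow> bool" where
  "finite_dimensional _ \<longleftrightarrow> (\<exists>B::'v set. finite B \<and> span B = UNIV)"

definition sharp_min_on :: "'v::real_normed_vector set \<Rightarrow> ('v \<Rightarrow> real) \<Rightarrow> 'v \<Rightarrow> bool" where
  "sharp_min_on X f p \<longleftrightarrow> p \<in> X \<and>
     (\<exists>\<rho>>0. \<forall>\<^sub>F x in at p within X. f x \<ge> f p + \<rho> * norm (x - p))"

text \<open>
  The derivative is taken relative to \<open>S\<close>, so that boundary points are covered and no
  extension of \<open>u\<close> outside \<open>S\<close> is needed.  If \<open>S\<close> has empty interior, \<open>g\<close> is not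
  determined by \<open>u\<close>; any continuous choice is then allowed as the gradient field.
\<close>

definition C1_gradient_on ::
    "'v::real_normed_vector set \<Rightarrow> ('v \<Rightarrow> real) \<Rightarrow> ('v \<Rightarrow> 'v \<Rightarrow>\<^sub>L real) \<Rightarrow> bool" where
  "C1_gradient_on S u g \<longleftrightarrow>
     (\<forall>x\<in>S. (u has_derivative blinfun_apply (g x)) (at x within S)) \<and> continuous_on S g"

definition strongly_convex_on ::
    "real \<Rightarrow> 'v::real_normed_vector set \<Rightarrow> ('v \<Rightarrow> real) \<Rightarrow> bool" where
  "strongly_convex_on K X h \<longleftrightarrow>
     (\<forall>x\<in>X. \<forall>x'\<in>X. \<forall>t\<in>{0..1}.
        h (t *\<^sub>R x + (1 - t) *\<^sub>R x')
          \<le> t * h x + (1 - t) * h x' - 1/2 * K * t * (1 - t) * (norm (x' - x))\<^sup>2)"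

definition regularizer :: "'v::real_normed_vector set \<Rightarrow> ('v \<Rightarrow> real) \<Rightarrow> bool" where
  "regularizer X h \<longleftrightarrow> continuous_on X h \<and> (\<exists>K>0. strongly_convex_on K X h)"

text \<open>
  For a regularizer on a nonempty compact convex set the maximizer exists and is unique, so
  the choice made by \<open>arg_max_on\<close> is immaterial, and the supremum in \<open>convex_conjugate\<close> is
  a maximum.
\<close>

definition mirror_map ::
    "'v::real_normed_vector set \<Rightarrow> ('v \<Rightarrow> real) \<Rightarrow> ('v \<Rightarrow>\<^sub>L real) \<Rightarrow> 'v" where
  "mirror_map X h y = arg_max_on (\<lambda>x. blinfun_apply y x - h x) X"

definition convex_conjugate ::
    "'v::real_normed_vector set \<Rightarrow> ('v \<Rightarrow> real) \<Rightarrow> ('v \<Rightarrow>\<^sub>L real) \<Rightarrow> real" where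
  "convex_conjugate X h y = (SUP x\<in>X. blinfun_apply y x - h x)"

definition fenchel_coupling ::
    "'v::real_normed_vector set \<Rightarrow> ('v \<Rightarrow> real) \<Rightarrow> 'v \<Rightarrow> ('v \<Rightarrow>\<^sub>L real) \<Rightarrow> real" where
  "fenchel_coupling X h p y = h p + convex_conjugate X h y - blinfun_apply y p"

text \<open>
  Stochastic mirror descent with gradient oracle \<open>G\<close>, step sizes \<open>\<gamma>\<close>, samples \<open>w\<close> and
  initial dual state \<open>y1\<close>.  Time starts at \<open>0\<close>: index \<open>n\<close> here is the (\<open>n + 1\<close>)-st
  iterate, step size and sample of the usual numbering \<open>1, 2, \<dots>\<close>.
\<close>

primrec smd_dual ::
    "(('v::real_normed_vector \<Rightarrow>\<^sub>L real) \<Rightarrow> 'v) \<Rightarrow> ('v \<Rightarrow> 'w \<Rightarrow> 'v \<Rightarrow>\<^sub>L real) \<Rightarrow>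
     (nat \<Rightarrow> real) \<Rightarrow> ('v \<Rightarrow>\<^sub>L real) \<Rightarrow> (nat \<Rightarrow> 's \<Rightarrow> 'w) \<Rightarrow> nat \<Rightarrow> 's \<Rightarrow> ('v \<Rightarrow>\<^sub>L real)" where
  "smd_dual Q G \<gamma> y1 w 0 s = y1"
| "smd_dual Q G \<gamma> y1 w (Suc n) s =
     smd_dual Q G \<gamma> y1 w n s - \<gamma> n *\<^sub>R G (Q (smd_dual Q G \<gamma> y1 w n s)) (w n s)"

definition smd_primal ::
    "(('v::real_normed_vector \<Rightarrow>\<^sub>L real) \<Rightarrow> 'v) \<Rightarrow> ('v \<Rightarrow> 'w \<Rightarrow> 'v \<Rightarrow>\<^sub>L real) \<Rightarrow>
     (nat \<Rightarrow> real) \<Rightarrow> ('v \<Rightarrow>\<^sub>L real) \<Rightarrow> (nat \<Rightarrow> 's \<Rightarrow> 'w) \<Rightarrow> nat \<Rightarrow> 's \<Rightarrow> 'v" where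
  "smd_primal Q G \<gamma> y1 w n s = Q (smd_dual Q G \<gamma> y1 w n s)"

text \<open>
  \<open>w\<close> is a sequence of independent random variables, defined on some probability space \<open>N\<close>,
  with values in \<open>M\<close> and with common law \<open>M\<close>.
\<close>

definition iid_samples :: "'s measure \<Rightarrow> 'w measure \<Rightarrow> (nat \<Rightarrow> 's \<Rightarrow> 'w) \<Rightarrow> bool" where
  "iid_samples N M w \<longleftrightarrow>
     prob_space.indep_vars N (\<lambda>_. M) w UNIV \<and> (\<forall>n. distr N M (w n) = M)"

end

theory Submission
  imports Defs
begin

text \<open>
  Sharpness gives \<open>\<langle>\<nabla>f(x\<^sup>*), z - x\<^sup>*\<rangle> \<ge> \<rho> \<parallel>z - x\<^sup>*\<parallel>\<close> on all of \<open>X\<close>, and by continuity of \<open>\<nabla>f\<close> the same holds,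
  with a smaller \<open>\<rho>\<close>, for \<open>\<nabla>f(x)\<close> with \<open>x\<close> near \<open>x\<^sup>*\<close>.  The Fenchel coupling \<open>\<Phi>(x\<^sup>*, Y\<^sub>n)\<close> then
  increases only through a martingale and a sum of squares, both of which stay below a fixed \<open>\<epsilon>\<close>
  with probability at least \<open>1 - \<delta>\<close> when \<open>\<Sum>\<gamma>\<^sub>n\<^sup>2\<close> is small (Kolmogorov, Markov); on that event the
  iterates never leave the neighbourhood.  While they stay there, the drift
  pushes \<open>\<langle>Y\<^sub>n, z - x\<^sup>*\<rangle>\<close> below \<open>-a\<^sub>n \<parallel>z - x\<^sup>*\<parallel>\<close> with \<open>a\<^sub>n \<rightarrow> \<infinity>\<close>, uniformly in \<open>z\<close>, because the noise
  accumulated in the dual is an \<open>L\<^sup>2\<close>-bounded martingale while \<open>\<Sum>\<gamma>\<^sub>n = \<infinity>\<close>.  By surjectivity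
  \<open>x\<^sup>* = Q(y)\<close> for some \<open>y\<close>, and \<open>Q(Y\<^sub>n) = x\<^sup>*\<close> as soon as \<open>a\<^sub>n > \<parallel>y\<parallel>\<close>.  Convergence of the iterates
  is never needed separately.
\<close>

section \<open>Duals of finite-dimensional spaces\<close>

text \<open>
  Gaussian elimination on the dual.  The type \<open>'v\<close> is not of class \<open>second_countable_topology\<close>, so
  measurability and mean values in the dual have to be obtained through such coordinates.
\<close>

lemma dual_coordinates:
  assumes "finite_dimensional TYPE('v::real_normed_vector)"
  obtains n :: nat and v :: "nat \<Rightarrow> 'v::real_normed_vector" and \<beta> :: "nat \<Rightarrow> 'v::real_normed_vector \<Rightarrow>\<^sub>L real"
  where "\<And>y. y = (\<Sum>i<n. blinfun_apply y (v i) *\<^sub>R \<beta> i)"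
proof -
  obtain B :: "'v set" where B: "finite B" "span B = UNIV"
    using assms by (auto simp: finite_dimensional_def)
  have "\<exists>(n::nat) (v :: nat \<Rightarrow> 'v) \<beta>. \<forall>y::'v \<Rightarrow>\<^sub>L real. \<forall>b\<in>B.
          blinfun_apply (y - (\<Sum>i<n. blinfun_apply y (v i) *\<^sub>R \<beta> i)) b = 0"
    using B(1)
  proof induction
    case empty
    then show ?case by simp
  next
    case (insert b B)
    then obtain n and v :: "nat \<Rightarrow> 'v" and \<beta> where
      IH: "\<And>(y::'v \<Rightarrow>\<^sub>L real) b'. b' \<in> B \<Longrightarrow>
          blinfun_apply (y - (\<Sum>i<n. blinfun_apply y (v i) *\<^sub>R \<beta> i)) b' = 0" by blast
    \<comment> \<open>\<open>P y\<close> is what the coordinates found so far leave of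
      \<open>y\<close>. By \<open>IH\<close> it vanishes on \<open>B\<close>, so only its value at
      \<open>b\<close> remains to be removed.\<close>
    define P where "P y = y - (\<Sum>i<n. blinfun_apply y (v i) *\<^sub>R \<beta> i)" for y
    show ?case
    proof (cases "\<forall>y. blinfun_apply (P y) b = 0")
      case True
      then show ?thesis using IH unfolding P_def by blast
    next
      case False
      then obtain y0 where y0: "blinfun_apply (P y0) b \<noteq> 0" by blast
      define z where "z = (1 / blinfun_apply (P y0) b) *\<^sub>R P y0"
      have zb: "blinfun_apply z b = 1" using y0 by (simp add: z_def scaleR_blinfun.rep_eq)
      have zB: "blinfun_apply z b' = 0" if "b' \<in> B" for b'
        using IH[OF that, of y0] unfolding z_def P_def by (simp add: scaleR_blinfun.rep_eq)
      \<comment> \<open>Coordinates must be evaluations at vectors. Transposing \<open>P\<close>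
        moves the correction from \<open>y\<close> onto \<open>b\<close>, so that the value of the
        remainder at \<open>b\<close> becomes the value of \<open>y\<close> at
        \<open>u\<close>.\<close>
      define u where "u = b - (\<Sum>i<n. blinfun_apply (\<beta> i) b *\<^sub>R v i)"
      have u: "blinfun_apply y u = blinfun_apply (P y) b" for y
        by (simp add: u_def P_def blinfun.diff_right blinfun.sum_right blinfun.scaleR_right
            blinfun.diff_left blinfun.sum_left blinfun.scaleR_left mult.commute)
      define v' where "v' = v(n := u)"
      define \<beta>' where "\<beta>' = \<beta>(n := z)"
      have "y - (\<Sum>i<Suc n. blinfun_apply y (v' i) *\<^sub>R \<beta>' i) = P y - blinfun_apply (P y) b *\<^sub>R z"
        for y
      proof -
        have "(\<Sum>i<n. blinfun_apply y (v' i) *\<^sub>R \<beta>' i) = (\<Sum>i<n. blinfun_apply y (v i) *\<^sub>R \<beta> i)"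
          by (intro sum.cong) (auto simp: v'_def \<beta>'_def)
        moreover have "blinfun_apply y (v' n) *\<^sub>R \<beta>' n = blinfun_apply (P y) b *\<^sub>R z"
          by (simp add: v'_def \<beta>'_def u)
        ultimately show ?thesis
          unfolding sum.lessThan_Suc P_def by (simp only: diff_diff_eq)
      qed
      moreover have "blinfun_apply (P y - blinfun_apply (P y) b *\<^sub>R z) b' = 0"
        if "b' \<in> insert b B" for y b'
        using that zb zB[of b'] IH[of b' y, folded P_def]
        by (auto simp: blinfun.diff_left blinfun.scaleR_left)
      ultimately have "\<forall>y. \<forall>b'\<in>insert b B.
          blinfun_apply (y - (\<Sum>i<Suc n. blinfun_apply y (v' i) *\<^sub>R \<beta>' i)) b' = 0"
        by presburger
      then show ?thesis by blast
    qed
  qed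
  then obtain n and v :: "nat \<Rightarrow> 'v" and \<beta> where
    *: "\<And>(y::'v \<Rightarrow>\<^sub>L real) b. b \<in> B \<Longrightarrow>
        blinfun_apply (y - (\<Sum>i<n. blinfun_apply y (v i) *\<^sub>R \<beta> i)) b = 0" by blast
  have "y = (\<Sum>i<n. blinfun_apply y (v i) *\<^sub>R \<beta> i)" for y :: "'v \<Rightarrow>\<^sub>L real"
  proof (rule blinfun_eqI)
    fix x :: 'v
    let ?z = "y - (\<Sum>i<n. blinfun_apply y (v i) *\<^sub>R \<beta> i)"
    have "blinfun_apply ?z x = 0"
    proof (rule linear_eq_0_on_span[of "blinfun_apply ?z" B])
      show "linear (blinfun_apply ?z)"
        by (simp add: blinfun.bounded_linear_right bounded_linear.linear)
    qed (use * B in auto)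
    then show "blinfun_apply y x = blinfun_apply (\<Sum>i<n. blinfun_apply y (v i) *\<^sub>R \<beta> i) x"
      by (simp add: blinfun.diff_left)
  qed
  then show thesis by (rule that)
qed

text \<open>By \<open>dual_coordinates\<close> a functional is a continuous image of its coordinate
  sequence in \<open>nat \<Rightarrow> real\<close>, and a map into that product is measurable once
  each coordinate is.\<close>

lemma borel_measurable_blinfunI:
  fixes Y :: "'s \<Rightarrow> 'v::real_normed_vector \<Rightarrow>\<^sub>L real"
  assumes "finite_dimensional TYPE('v)"
    and Y: "\<And>u. (\<lambda>s. blinfun_apply (Y s) u) \<in> borel_measurable M"
  shows "Y \<in> borel_measurable M"
proof -
  obtain n :: nat and v :: "nat \<Rightarrow> 'v" and \<beta> where
    repr: "\<And>y. y = (\<Sum>i<n. blinfun_apply y (v i) *\<^sub>R \<beta> i)"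
    using dual_coordinates[OF assms(1)] by metis
  define L where "L c = (\<Sum>i<n. c i *\<^sub>R \<beta> i)" for c :: "nat \<Rightarrow> real"
  have "continuous_on UNIV L"
    unfolding L_def by (intro continuous_intros continuous_on_product_coordinates)
  then have L: "L \<in> borel_measurable borel"
    by (rule borel_measurable_continuous_onI)
  have "(\<lambda>s i. blinfun_apply (Y s) (v i)) \<in> borel_measurable M"
    by (intro measurable_coordinatewise_then_product Y)
  from measurable_compose[OF this L]
  have "(\<lambda>s. \<Sum>i<n. blinfun_apply (Y s) (v i) *\<^sub>R \<beta> i) \<in> borel_measurable M"
    by (simp add: L_def)
  then show ?thesis by (simp flip: repr)
qed

lemma borel_measurable_blinfun_apply:
  fixes Y :: "'s \<Rightarrow> 'v::real_normed_vector \<Rightarrow>\<^sub>L real"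
  assumes "Y \<in> borel_measurable M"
  shows "(\<lambda>s. blinfun_apply (Y s) u) \<in> borel_measurable M"
  by (rule measurable_compose[OF assms])
     (intro borel_measurable_continuous_onI continuous_intros)

text \<open>Turns scalar estimates at finitely many vectors into estimates of the dual norm, for the
  continuity of the mean gradient and for the accumulated dual noise.\<close>

lemma norm_blinfun_le_coordinates:
  assumes "finite_dimensional TYPE('v::real_normed_vector)"
  obtains n :: nat and v :: "nat \<Rightarrow> 'v::real_normed_vector" and c :: "nat \<Rightarrow> real"
  where "\<And>y :: 'v::real_normed_vector \<Rightarrow>\<^sub>L real. norm y \<le> (\<Sum>i<n. c i * \<bar>blinfun_apply y (v i)\<bar>)"
    and "\<And>i. c i \<ge> 0"
proof -
  obtain n :: nat and v :: "nat \<Rightarrow> 'v" and \<beta> where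
    repr: "\<And>y. y = (\<Sum>i<n. blinfun_apply y (v i) *\<^sub>R \<beta> i)"
    using dual_coordinates[OF assms(1)] by metis
  have "norm y \<le> (\<Sum>i<n. norm (\<beta> i) * \<bar>blinfun_apply y (v i)\<bar>)" for y :: "'v \<Rightarrow>\<^sub>L real"
  proof -
    have "norm y = norm (\<Sum>i<n. blinfun_apply y (v i) *\<^sub>R \<beta> i)"
      by (simp flip: repr)
    also have "\<dots> \<le> (\<Sum>i<n. norm (blinfun_apply y (v i) *\<^sub>R \<beta> i))"
      by (rule norm_sum)
    finally show ?thesis by (simp add: mult.commute)
  qed
  then show thesis by (rule that) simp
qed

text \<open>The mean is a weak integral, put together from the means of the coordinates.\<close>

lemma blinfun_mean_exists:
  fixes Y :: "'w \<Rightarrow> 'v::real_normed_vector \<Rightarrow>\<^sub>L real"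
  assumes "finite_dimensional TYPE('v)"
    and Y: "\<And>u. integrable M (\<lambda>s. blinfun_apply (Y s) u)"
  shows "\<exists>g :: 'v \<Rightarrow>\<^sub>L real. \<forall>u. blinfun_apply g u = (\<integral>s. blinfun_apply (Y s) u \<partial>M)"
proof -
  obtain n :: nat and v :: "nat \<Rightarrow> 'v" and \<beta> where
    repr: "\<And>y. y = (\<Sum>i<n. blinfun_apply y (v i) *\<^sub>R \<beta> i)"
    using dual_coordinates[OF assms(1)] by metis
  define g where "g = (\<Sum>i<n. (\<integral>s. blinfun_apply (Y s) (v i) \<partial>M) *\<^sub>R \<beta> i)"
  have "blinfun_apply g u = (\<integral>s. blinfun_apply (Y s) u \<partial>M)" for u
  proof -
    have "blinfun_apply (Y s) u = (\<Sum>i<n. blinfun_apply (Y s) (v i) * blinfun_apply (\<beta> i) u)" for s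
      by (subst repr) (simp add: blinfun.sum_left blinfun.scaleR_left)
    then show ?thesis
      by (simp add: g_def blinfun.sum_left blinfun.scaleR_left Y)
  qed
  then show ?thesis by blast
qed

text \<open>Expanding \<open>A s\<close> in coordinates gives a finite sum of products, each factor
  of which involves only one of \<open>A\<close> and \<open>U\<close>.\<close>

lemma borel_measurable_blinfun_pairing:
  fixes A :: "'s \<Rightarrow> 'v::real_normed_vector \<Rightarrow>\<^sub>L real"
  assumes "finite_dimensional TYPE('v)"
    and A: "A \<in> borel_measurable S" and U: "U \<in> borel_measurable S"
  shows "(\<lambda>s. blinfun_apply (A s) (U s)) \<in> borel_measurable S"
proof -
  obtain n :: nat and v :: "nat \<Rightarrow> 'v" and \<beta> where
    repr: "\<And>y. y = (\<Sum>i<n. blinfun_apply y (v i) *\<^sub>R \<beta> i)"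
    using dual_coordinates[OF assms(1)] by metis
  have U': "(\<lambda>s. blinfun_apply b (U s)) \<in> borel_measurable S" for b :: "'v \<Rightarrow>\<^sub>L real"
    by (rule measurable_compose[OF U]) (intro borel_measurable_continuous_onI continuous_intros)
  have "(\<lambda>s. \<Sum>i<n. blinfun_apply (A s) (v i) * blinfun_apply (\<beta> i) (U s)) \<in> borel_measurable S"
    by (rule borel_measurable_sum, rule borel_measurable_times,
        rule borel_measurable_blinfun_apply[OF A], rule U')
  moreover have "(\<lambda>s. blinfun_apply (A s) (U s))
      = (\<lambda>s. \<Sum>i<n. blinfun_apply (A s) (v i) * blinfun_apply (\<beta> i) (U s))"
  proof
    fix s
    show "blinfun_apply (A s) (U s) = (\<Sum>i<n. blinfun_apply (A s) (v i) * blinfun_apply (\<beta> i) (U s))"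
      by (subst repr) (simp add: blinfun.sum_left blinfun.scaleR_left)
  qed
  ultimately show ?thesis by (simp only:)
qed

section \<open>Mirror maps and the Fenchel coupling\<close>

lemma mirror_map_in:
  assumes "X \<noteq> {}" "compact X" "continuous_on X h"
  shows "mirror_map X h y \<in> X"
    and "x \<in> X \<Longrightarrow> blinfun_apply y x - h x
          \<le> blinfun_apply y (mirror_map X h y) - h (mirror_map X h y)"
proof -
  have "continuous_on X (\<lambda>x. blinfun_apply y x - h x)"
    by (intro continuous_intros assms)
  from continuous_attains_sup[OF assms(2,1) this]
  obtain m where m: "m \<in> X" "\<And>x. x \<in> X \<Longrightarrow> blinfun_apply y x - h x \<le> blinfun_apply y m - h m"
    by blast
  have "is_arg_max (\<lambda>x. blinfun_apply y x - h x) (\<lambda>x. x \<in> X) m"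
    using m by (auto simp: is_arg_max_linorder)
  then have *: "is_arg_max (\<lambda>x. blinfun_apply y x - h x) (\<lambda>x. x \<in> X) (mirror_map X h y)"
    unfolding mirror_map_def arg_max_on_def arg_max_def by (rule someI)
  from * show "mirror_map X h y \<in> X" by (simp add: is_arg_max_linorder)
  from * show "x \<in> X \<Longrightarrow> blinfun_apply y x - h x
          \<le> blinfun_apply y (mirror_map X h y) - h (mirror_map X h y)"
    by (simp add: is_arg_max_linorder)
qed

locale mirror_setup =
  fixes X :: "'v::real_normed_vector set" and h :: "'v \<Rightarrow> real" and K :: real
  assumes ne: "X \<noteq> {}" and compact: "compact X" and convex: "convex X"
    and cont: "continuous_on X h" and K: "K > 0" and strong: "strongly_convex_on K X h"
begin

abbreviation "Q \<equiv> mirror_map X h"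

lemma Q_in: "Q y \<in> X"
  using mirror_map_in(1)[OF ne compact cont] .

text \<open>First-order optimality with the gain from strong convexity: compare \<open>Q y\<close>
  with the point at fraction \<open>t\<close> of the way to \<open>x\<close>, divide by
  \<open>t\<close> and let \<open>t\<close> tend to 0.\<close>

lemma Q_strong_opt:
  assumes "x \<in> X"
  shows "h (Q y) + blinfun_apply y (x - Q y) + K/2 * (norm (x - Q y))\<^sup>2 \<le> h x"
proof (rule field_le_epsilon)
  fix e :: real assume "e > 0"
  let ?q = "Q y" and ?N = "(norm (x - Q y))\<^sup>2"
  \<comment> \<open>This \<open>t\<close> keeps the lost part of the quadratic term below
    \<open>e\<close>; the \<open>+ 1\<close> covers \<open>x = Q y\<close>, where \<open>?N\<close>
    is 0.\<close>
  define t where "t = min 1 (e / (K/2 * ?N + 1))"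
  have pos: "K/2 * ?N + 1 > 0" using K by (intro add_nonneg_pos) auto
  have t: "t > 0" "t \<le> 1" using \<open>e > 0\<close> pos by (auto simp: t_def)
  have "t * (K/2 * ?N + 1) \<le> e"
    using pos by (subst pos_le_divide_eq[symmetric]) (auto simp: t_def)
  then have te: "t * (K/2 * ?N) \<le> e" using t by (simp add: algebra_simps)
  let ?m = "t *\<^sub>R x + (1 - t) *\<^sub>R ?q"
  have m: "?m \<in> X" using convexD[OF convex assms Q_in, of t "1 - t"] t by simp
  have "h ?m \<le> t * h x + (1 - t) * h ?q - 1/2 * K * t * (1 - t) * (norm (?q - x))\<^sup>2"
    using strong assms Q_in t unfolding strongly_convex_on_def by auto
  moreover have "blinfun_apply y ?m - h ?m \<le> blinfun_apply y ?q - h ?q"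
    using mirror_map_in(2)[OF ne compact cont m] .
  moreover have "blinfun_apply y ?m = blinfun_apply y ?q + t * blinfun_apply y (x - ?q)"
    by (simp add: blinfun.add_right blinfun.scaleR_right blinfun.diff_right algebra_simps)
  ultimately have "t * (h ?q + blinfun_apply y (x - ?q) + 1/2 * K * (1 - t) * ?N) \<le> t * h x"
    by (simp add: norm_minus_commute algebra_simps)
  then have *: "h ?q + blinfun_apply y (x - ?q) + 1/2 * K * (1 - t) * ?N \<le> h x"
    using t by simp
  show "h ?q + blinfun_apply y (x - ?q) + K/2 * ?N \<le> h x + e"
  proof -
    have "1/2 * K * (1 - t) * ?N = K/2 * ?N - t * (K/2 * ?N)" by (simp add: field_simps)
    with * te show ?thesis by linarith
  qed
qed

lemma convex_conjugate_eq: "convex_conjugate X h y = blinfun_apply y (Q y) - h (Q y)"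
  unfolding convex_conjugate_def
  by (rule cSup_eq_maximum) (use Q_in mirror_map_in(2)[OF ne compact cont] in auto)

text \<open>The form of a Bregman divergence of \<open>h\<close> from \<open>Q y\<close> to
  \<open>p\<close>, with \<open>y\<close> in the place of the gradient at
  \<open>Q y\<close>.\<close>

lemma fenchel_coupling_eq:
  "fenchel_coupling X h p y = h p - h (Q y) - blinfun_apply y (p - Q y)"
  by (simp add: fenchel_coupling_def convex_conjugate_eq blinfun.diff_right)

lemma fenchel_coupling_ge:
  assumes "p \<in> X"
  shows "fenchel_coupling X h p y \<ge> K/2 * (norm (Q y - p))\<^sup>2"
  using Q_strong_opt[OF assms, of y] by (simp add: fenchel_coupling_eq norm_minus_commute)

text \<open>Energy inequality for one step. The motion of the maximiser costs the pairing of
  \<open>v\<close> with \<open>?d\<close>; Young's inequality splits it so that the quadratic term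
  is cancelled exactly by the gain in \<open>Q_strong_opt\<close>.\<close>

lemma fenchel_coupling_step:
  "fenchel_coupling X h p (y + v)
    \<le> fenchel_coupling X h p y + blinfun_apply v (Q y - p) + (norm v)\<^sup>2 / (2 * K)"
proof -
  let ?d = "Q (y + v) - Q y"
  have "blinfun_apply v ?d \<le> norm v * norm ?d"
    using norm_blinfun[of v ?d] by simp
  also have "\<dots> \<le> K/2 * (norm ?d)\<^sup>2 + (norm v)\<^sup>2 / (2 * K)"
  proof -
    have "0 \<le> (K * norm ?d - norm v)\<^sup>2 / (2 * K)" using K by simp
    also have "\<dots> = K/2 * (norm ?d)\<^sup>2 + (norm v)\<^sup>2 / (2 * K) - norm v * norm ?d"
      using K by (simp add: power2_eq_square field_simps)
    finally show ?thesis by simp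
  qed
  finally have "blinfun_apply v ?d \<le> K/2 * (norm ?d)\<^sup>2 + (norm v)\<^sup>2 / (2 * K)" .
  then show ?thesis
    using Q_strong_opt[OF Q_in, of y "y + v"]
    by (simp add: fenchel_coupling_eq blinfun.diff_right blinfun.add_left algebra_simps)
qed

text \<open>Adding the optimality inequalities of \<open>Q y\<close> and \<open>Q y'\<close>, each
  tested at the other point, gives strong monotonicity.\<close>

lemma Q_lipschitz: "norm (Q y - Q y') \<le> norm (y - y') / K"
proof -
  let ?d = "Q y - Q y'"
  have "K * (norm ?d)\<^sup>2 \<le> blinfun_apply (y - y') ?d"
    using Q_strong_opt[OF Q_in, of y y'] Q_strong_opt[OF Q_in, of y' y]
    by (simp add: blinfun.diff_right blinfun.diff_left norm_minus_commute algebra_simps)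
  also have "\<dots> \<le> norm (y - y') * norm ?d"
    using norm_blinfun[of "y - y'" ?d] by simp
  finally have "norm ?d * (K * norm ?d) \<le> norm ?d * norm (y - y')"
    by (simp add: power2_eq_square algebra_simps)
  then have "K * norm ?d \<le> norm (y - y')"
    by (cases "norm ?d = 0") (auto simp: mult_le_cancel_left)
  then show ?thesis using K by (simp add: field_simps)
qed

lemma continuous_on_Q: "continuous_on UNIV Q"
proof (rule lipschitz_on_continuous_on)
  show "(1/K)-lipschitz_on UNIV Q"
    using K Q_lipschitz by (intro lipschitz_onI) (auto simp: dist_norm)
qed

lemma Q_eqI:
  assumes "p \<in> X" "\<And>x. \<lbrakk>x \<in> X; x \<noteq> p\<rbrakk> \<Longrightarrow> blinfun_apply y x - h x < blinfun_apply y p - h p"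
  shows "Q y = p"
  using assms Q_in[of y] mirror_map_in(2)[OF ne compact cont assms(1), of y] by force

text \<open>As \<open>Q y0\<close> is optimal for \<open>y0\<close>, \<open>h\<close> falls off from
  \<open>Q y0\<close> at a rate of at most \<open>norm y0\<close>; a functional that decreases
  faster has the same point as its unique maximiser.\<close>

lemma Q_eq_of_steep:
  assumes "\<And>x. x \<in> X \<Longrightarrow> blinfun_apply y (x - Q y0) \<le> - a * norm (x - Q y0)" "a > norm y0"
  shows "Q y = Q y0"
proof (rule Q_eqI)
  fix x assume x: "x \<in> X" "x \<noteq> Q y0"
  have "blinfun_apply y x - h x - (blinfun_apply y (Q y0) - h (Q y0))
        \<le> - a * norm (x - Q y0) - blinfun_apply y0 (x - Q y0)"
    using assms(1)[OF x(1)] mirror_map_in(2)[OF ne compact cont x(1), of y0]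
    by (simp add: blinfun.diff_right)
  also have "\<dots> \<le> (norm y0 - a) * norm (x - Q y0)"
    using norm_blinfun[of y0 "x - Q y0"] by (simp add: algebra_simps)
  also have "\<dots> < 0" using x assms(2) by (simp add: mult_less_0_iff)
  finally show "blinfun_apply y x - h x < blinfun_apply y (Q y0) - h (Q y0)" by simp
qed (rule Q_in)

text \<open>The coupling depends on \<open>y\<close> and not on \<open>Q y\<close> alone, so its
  smallness must hold uniformly over all dual points mapped near \<open>p\<close>. A failure at
  every radius \<open>1/(n + 1)\<close> would give a sequence contradicting the sequential
  hypothesis.\<close>

lemma fenchel_coupling_small_nhd:
  assumes "\<And>y. (\<lambda>n::nat. Q (y n)) \<longlonglongrightarrow> p \<Longrightarrow> (\<lambda>n. fenchel_coupling X h p (y n)) \<longlonglongrightarrow> 0"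
    and "e > 0"
  obtains r where "r > 0" "\<And>y. norm (Q y - p) < r \<Longrightarrow> fenchel_coupling X h p y < e"
proof (rule ccontr)
  assume "\<not> thesis"
  then have "\<And>r. r > 0 \<Longrightarrow> \<exists>y. norm (Q y - p) < r \<and> fenchel_coupling X h p y \<ge> e"
    using that by (metis not_le)
  then have "\<forall>n::nat. \<exists>y. norm (Q y - p) < inverse (real (Suc n)) \<and> fenchel_coupling X h p y \<ge> e"
    by simp
  then obtain y where y: "\<And>n::nat. norm (Q (y n) - p) < inverse (real (Suc n))"
      "\<And>n. fenchel_coupling X h p (y n) \<ge> e"
    by metis
  have "(\<lambda>n. Q (y n)) \<longlonglongrightarrow> p"
    by (rule Lim_null[THEN iffD2], rule Lim_null_comparison[OF _ LIMSEQ_inverse_real_of_nat])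
       (use y(1) in \<open>auto intro!: always_eventually less_imp_le simp del: of_nat_Suc\<close>)
  from assms(1)[OF this] have "(\<lambda>n. fenchel_coupling X h p (y n)) \<longlonglongrightarrow> 0" .
  from LIMSEQ_le_const[OF this, of e] y(2) \<open>e > 0\<close> show False by auto
qed

end

text \<open>Deterministic core: \<open>y\<close> is one trajectory, \<open>g\<close> its sampled
  gradients, \<open>m\<close> the mean field, and chance enters only through the bounds
  \<open>S\<close>, \<open>R\<close> and \<open>C\<close>. The first two keep the path in the ball
  around \<open>p\<close>; the third lets the drift win in the dual.\<close>

lemma (in mirror_setup) dual_path_reaches:
  fixes y g :: "nat \<Rightarrow> 'v \<Rightarrow>\<^sub>L real" and m :: "'v \<Rightarrow> 'v \<Rightarrow>\<^sub>L real"
  assumes y: "\<And>n. y (Suc n) = y n - \<gamma> n *\<^sub>R g n"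
    and \<gamma>: "\<And>n. \<gamma> n > 0" "\<not> summable \<gamma>"
    and p: "p \<in> X" "Q y0 = p"
    and "\<rho> > 0" and "r > 0"
    and drift: "\<And>x z. \<lbrakk>x \<in> X; norm (x - p) < r; z \<in> X\<rbrakk> \<Longrightarrow>
                  blinfun_apply (m x) (z - p) \<ge> \<rho> * norm (z - p)"
    and \<epsilon>: "6 * \<epsilon> \<le> K * r\<^sup>2" "fenchel_coupling X h p (y 0) < \<epsilon>"
    and S: "\<And>n. \<bar>\<Sum>k<n. \<gamma> k * blinfun_apply (g k - m (Q (y k))) (Q (y k) - p)\<bar> < \<epsilon>"
    and R: "\<And>n. (\<Sum>k<n. (\<gamma> k)\<^sup>2 * (norm (g k))\<^sup>2 / (2 * K)) < \<epsilon>"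
    and C: "\<And>n. norm (\<Sum>k<n. \<gamma> k *\<^sub>R (g k - m (Q (y k)))) \<le> C"
  shows "\<forall>\<^sub>F n in sequentially. Q (y n) = p"
proof -
  let ?\<Phi> = "\<lambda>n. fenchel_coupling X h p (y n)"
  let ?S = "\<lambda>n. \<Sum>k<n. \<gamma> k * blinfun_apply (g k - m (Q (y k))) (Q (y k) - p)"
  let ?R = "\<lambda>n. \<Sum>k<n. (\<gamma> k)\<^sup>2 * (norm (g k))\<^sup>2 / (2 * K)"
  have step: "?\<Phi> (Suc n) \<le> ?\<Phi> n - \<gamma> n * blinfun_apply (g n - m (Q (y n))) (Q (y n) - p)
      + (\<gamma> n)\<^sup>2 * (norm (g n))\<^sup>2 / (2 * K)" if "norm (Q (y n) - p) < r" for n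
  proof -
    have "0 \<le> \<rho> * norm (Q (y n) - p)" using \<open>\<rho> > 0\<close> by simp
    also have "\<dots> \<le> blinfun_apply (m (Q (y n))) (Q (y n) - p)"
      by (rule drift[OF Q_in that Q_in])
    finally have "0 \<le> \<gamma> n * blinfun_apply (m (Q (y n))) (Q (y n) - p)"
      using \<gamma>(1)[of n] by simp
    moreover have "?\<Phi> (Suc n) \<le> ?\<Phi> n - \<gamma> n * blinfun_apply (g n) (Q (y n) - p)
      + (\<gamma> n)\<^sup>2 * (norm (g n))\<^sup>2 / (2 * K)"
      using fenchel_coupling_step[of p "y n" "- \<gamma> n *\<^sub>R g n"]
      by (simp add: y blinfun.scaleR_left blinfun.minus_left power_mult_distrib)
    ultimately show ?thesis by (simp add: blinfun.diff_left right_diff_distrib)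
  qed
  have bound: "?\<Phi> n \<le> ?\<Phi> 0 - ?S n + ?R n" if "\<And>k. k < n \<Longrightarrow> norm (Q (y k) - p) < r" for n
    using that
  proof (induction n)
    case (Suc n)
    with step[of n] show ?case by simp
  qed simp
  \<comment> \<open>Strong induction closes because \<open>bound\<close> at time \<open>n\<close>
    uses the ball only before \<open>n\<close>. Start, martingale and squares contribute less than
    \<open>\<epsilon>\<close> each, and \<open>6 * \<epsilon> \<le> K * r\<^sup>2\<close>.\<close>
  have near: "norm (Q (y n) - p) < r" for n
  proof (induction n rule: less_induct)
    case (less n)
    have "K/2 * (norm (Q (y n) - p))\<^sup>2 \<le> ?\<Phi> n" by (rule fenchel_coupling_ge[OF p(1)])
    also have "\<dots> < 3 * \<epsilon>"
    proof -
      have "?\<Phi> n \<le> ?\<Phi> 0 - ?S n + ?R n" by (rule bound) (rule less.IH)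
      then show ?thesis using S[of n] R[of n] \<epsilon>(2) by linarith
    qed
    also have "\<dots> \<le> K/2 * r\<^sup>2" using \<epsilon>(1) by simp
    finally have "(norm (Q (y n) - p))\<^sup>2 < r\<^sup>2" using K by simp
    then show ?case by (rule power2_less_imp_less) (use \<open>r > 0\<close> in simp)
  qed
  \<comment> \<open>Separates the drift, which grows with the sum of the steps, from the noise,
    which \<open>C\<close> bounds.\<close>
  have y_eq: "y n = y 0 - (\<Sum>k<n. \<gamma> k *\<^sub>R m (Q (y k))) - (\<Sum>k<n. \<gamma> k *\<^sub>R (g k - m (Q (y k))))" for n
  proof (induction n)
    case (Suc n)
    have regroup: "a - b - c - d - e = a - (b + d) - (c + e)" for a b c d e :: "'v \<Rightarrow>\<^sub>L real"
      by simp
    have "y (Suc n) = y n - \<gamma> n *\<^sub>R m (Q (y n)) - \<gamma> n *\<^sub>R (g n - m (Q (y n)))"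
      by (simp add: y scaleR_diff_right)
    also have "\<dots> = y 0 - (\<Sum>k<n. \<gamma> k *\<^sub>R m (Q (y k))) - (\<Sum>k<n. \<gamma> k *\<^sub>R (g k - m (Q (y k))))
        - \<gamma> n *\<^sub>R m (Q (y n)) - \<gamma> n *\<^sub>R (g n - m (Q (y n)))"
      using Suc.IH
      by (rule arg_cong[where f="\<lambda>z. z - \<gamma> n *\<^sub>R m (Q (y n)) - \<gamma> n *\<^sub>R (g n - m (Q (y n)))"])
    finally show ?case unfolding sum.lessThan_Suc regroup .
  qed simp
  have steep: "blinfun_apply (y n) (x - p) \<le> - (\<rho> * (\<Sum>k<n. \<gamma> k) - norm (y 0) - C) * norm (x - p)"
    if x: "x \<in> X" for n x
  proof -
    have "blinfun_apply (y 0) (x - p) \<le> norm (y 0) * norm (x - p)"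
      using norm_blinfun[of "y 0" "x - p"] by simp
    moreover have "- blinfun_apply (\<Sum>k<n. \<gamma> k *\<^sub>R (g k - m (Q (y k)))) (x - p) \<le> C * norm (x - p)"
      using norm_blinfun[of "\<Sum>k<n. \<gamma> k *\<^sub>R (g k - m (Q (y k)))" "x - p"]
        mult_right_mono[OF C[of n] norm_ge_zero[of "x - p"]] by simp
    moreover have "\<rho> * (\<Sum>k<n. \<gamma> k) * norm (x - p)
        \<le> blinfun_apply (\<Sum>k<n. \<gamma> k *\<^sub>R m (Q (y k))) (x - p)"
    proof -
      have "\<rho> * (\<Sum>k<n. \<gamma> k) * norm (x - p) = (\<Sum>k<n. \<gamma> k * (\<rho> * norm (x - p)))"
        by (simp add: sum_distrib_left sum_distrib_right mult_ac)
      also have "\<dots> \<le> (\<Sum>k<n. \<gamma> k * blinfun_apply (m (Q (y k))) (x - p))"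
        using \<gamma>(1) by (intro sum_mono mult_left_mono drift[OF Q_in near x]) (simp add: less_imp_le)
      finally show ?thesis by (simp add: blinfun.sum_left blinfun.scaleR_left)
    qed
    ultimately show ?thesis
      by (subst y_eq) (simp add: blinfun.diff_left left_diff_distrib)
  qed
  \<comment> \<open>From \<open>n0\<close> on the slope in \<open>steep\<close> exceeds
    \<open>norm y0\<close>. Without such an \<open>n0\<close> the positive steps would have bounded
    partial sums and be summable.\<close>
  obtain n0 where n0: "(norm y0 + norm (y 0) + C) / \<rho> < (\<Sum>k<n0. \<gamma> k)"
  proof (rule ccontr)
    assume "\<not> thesis"
    then have B: "(\<Sum>k<n. \<gamma> k) \<le> (norm y0 + norm (y 0) + C) / \<rho>" for n
      using that by (meson not_le)
    have "summable \<gamma>"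
      by (rule bounded_imp_summable[OF less_imp_le[OF \<gamma>(1)]])
         (unfold lessThan_Suc_atMost[symmetric], rule B)
    with \<gamma>(2) show False by simp
  qed
  show ?thesis
  proof (rule eventually_sequentiallyI[of n0])
    fix n assume "n0 \<le> n"
    then have "(\<Sum>k<n0. \<gamma> k) \<le> (\<Sum>k<n. \<gamma> k)"
      using \<gamma>(1) by (intro sum_mono2) (auto intro: less_imp_le)
    with n0 have "(norm y0 + norm (y 0) + C) / \<rho> < (\<Sum>k<n. \<gamma> k)" by simp
    then have "norm y0 < \<rho> * (\<Sum>k<n. \<gamma> k) - norm (y 0) - C"
      using \<open>\<rho> > 0\<close> by (simp add: field_simps)
    with steep[of _ n] show "Q (y n) = p"
      unfolding p(2)[symmetric] by (intro Q_eq_of_steep) auto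
  qed
qed

section \<open>Bounds in \<open>L\<^sup>2\<close>\<close>

lemma (in prob_space) second_moment_bound:
  assumes [measurable]: "\<phi> \<in> borel_measurable M" and "C \<ge> 0"
    and C: "(\<integral>\<^sup>+x. ennreal ((\<phi> x)\<^sup>2) \<partial>M) \<le> ennreal C"
  shows "integrable M (\<lambda>x. (\<phi> x)\<^sup>2)" "(\<integral>x. (\<phi> x)\<^sup>2 \<partial>M) \<le> C" "integrable M \<phi>"
proof -
  show sq: "integrable M (\<lambda>x. (\<phi> x)\<^sup>2)"
    using C by (intro integrableI_bounded) (auto simp: le_less_trans)
  show "(\<integral>x. (\<phi> x)\<^sup>2 \<partial>M) \<le> C"
    using \<open>C \<ge> 0\<close> C by (rule integral_real_bounded)
  show "integrable M \<phi>"
    using sq by (rule square_integrable_imp_integrable[rotated]) measurable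
qed

text \<open>Bounded second moments give uniform integrability, so almost sure convergence carries
  over to the means (Vitali). The difference is truncated at a level \<open>L\<close>: dominated
  convergence treats the truncation, the second moment treats the tail.\<close>

lemma (in prob_space) L2_bounded_convergence:
  fixes \<phi> :: "nat \<Rightarrow> 'a \<Rightarrow> real"
  assumes [measurable]: "\<And>n. \<phi> n \<in> borel_measurable M" "\<psi> \<in> borel_measurable M"
    and lim: "AE x in M. (\<lambda>n. \<phi> n x) \<longlonglongrightarrow> \<psi> x"
    and "C \<ge> 0" and C: "\<And>n. (\<integral>\<^sup>+x. ennreal ((\<phi> n x)\<^sup>2) \<partial>M) \<le> ennreal C"
  shows "(\<lambda>n. \<integral>x. \<phi> n x \<partial>M) \<longlonglongrightarrow> (\<integral>x. \<psi> x \<partial>M)"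
proof -
  have "(\<integral>\<^sup>+x. ennreal ((\<psi> x)\<^sup>2) \<partial>M) = (\<integral>\<^sup>+x. liminf (\<lambda>n. ennreal ((\<phi> n x)\<^sup>2)) \<partial>M)"
  proof (rule nn_integral_cong_AE)
    show "AE x in M. ennreal ((\<psi> x)\<^sup>2) = liminf (\<lambda>n. ennreal ((\<phi> n x)\<^sup>2))"
      using lim
    proof eventually_elim
      case (elim x)
      then have "(\<lambda>n. ennreal ((\<phi> n x)\<^sup>2)) \<longlonglongrightarrow> ennreal ((\<psi> x)\<^sup>2)"
        by (intro tendsto_ennrealI tendsto_power)
      then show ?case by (intro lim_imp_Liminf[symmetric]) auto
    qed
  qed
  also have "\<dots> \<le> liminf (\<lambda>n. \<integral>\<^sup>+x. ennreal ((\<phi> n x)\<^sup>2) \<partial>M)"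
    by (intro nn_integral_liminf) measurable
  also have "\<dots> \<le> liminf (\<lambda>n::nat. ennreal C)"
    using C by (intro Liminf_mono always_eventually) auto
  \<comment> \<open>By Fatou's lemma the limit inherits the bound.\<close>
  finally have \<psi>C: "(\<integral>\<^sup>+x. ennreal ((\<psi> x)\<^sup>2) \<partial>M) \<le> ennreal C"
    by (simp add: Liminf_const)
  note \<phi>2 = second_moment_bound[OF assms(1) \<open>C \<ge> 0\<close> C]
  note \<psi>2 = second_moment_bound[OF assms(2) \<open>C \<ge> 0\<close> \<psi>C]
  define D where "D n x = \<bar>\<phi> n x - \<psi> x\<bar>" for n x
  have [measurable]: "D n \<in> borel_measurable M" for n unfolding D_def by measurable
  have D2: "integrable M (\<lambda>x. (D n x)\<^sup>2)" "(\<integral>x. (D n x)\<^sup>2 \<partial>M) \<le> 4 * C" for n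
  proof -
    have le: "(D n x)\<^sup>2 \<le> 2 * (\<phi> n x)\<^sup>2 + 2 * (\<psi> x)\<^sup>2" for x
      using sum_squares_ge_zero[of "\<phi> n x + \<psi> x" 0]
      by (simp add: D_def power2_eq_square algebra_simps)
    show i: "integrable M (\<lambda>x. (D n x)\<^sup>2)"
      by (rule Bochner_Integration.integrable_bound[where f="\<lambda>x. 2 * (\<phi> n x)\<^sup>2 + 2 * (\<psi> x)\<^sup>2"])
         (use le \<phi>2 \<psi>2 in \<open>auto intro!: AE_I2\<close>)
    have "(\<integral>x. (D n x)\<^sup>2 \<partial>M) \<le> (\<integral>x. 2 * (\<phi> n x)\<^sup>2 + 2 * (\<psi> x)\<^sup>2 \<partial>M)"
      using le by (intro integral_mono i) (auto simp: \<phi>2 \<psi>2)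
    also have "\<dots> = 2 * (\<integral>x. (\<phi> n x)\<^sup>2 \<partial>M) + 2 * (\<integral>x. (\<psi> x)\<^sup>2 \<partial>M)"
      by (simp add: \<phi>2(1) \<psi>2(1))
    also have "\<dots> \<le> 4 * C" using \<phi>2(2)[of n] \<psi>2(2) by linarith
    finally show "(\<integral>x. (D n x)\<^sup>2 \<partial>M) \<le> 4 * C" .
  qed
  have "(\<lambda>n. \<bar>(\<integral>x. \<phi> n x \<partial>M) - (\<integral>x. \<psi> x \<partial>M)\<bar>) \<longlonglongrightarrow> 0"
  proof (rule order_tendstoI)
    fix e :: real assume "e > 0"
    \<comment> \<open>Chosen so that the tail beyond \<open>L\<close>, at most
      \<open>4 * C / L\<close> by \<open>D2\<close> and \<open>min_le\<close>, is below
      \<open>e / 2\<close>.\<close>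
    define L where "L = 8 * C / e + 1"
    have L: "L > 0" "4 * C / L < e / 2"
      using \<open>e > 0\<close> \<open>C \<ge> 0\<close> by (auto simp: L_def field_simps add_pos_nonneg add_nonneg_pos)
    have min_le: "D n x \<le> min (D n x) L + (D n x)\<^sup>2 / L" for n x
    proof (cases "D n x \<le> L")
      case False
      then have "D n x * L \<le> (D n x)\<^sup>2" using L by (simp add: power2_eq_square)
      then have "D n x \<le> (D n x)\<^sup>2 / L" using L by (simp add: field_simps)
      with L False show ?thesis by simp
    qed (use L in auto)
    have "(\<lambda>n. \<integral>x. min (D n x) L \<partial>M) \<longlonglongrightarrow> (\<integral>x. 0 \<partial>M)"
    proof (rule integral_dominated_convergence[where w="\<lambda>_. L"])
      show "AE x in M. (\<lambda>n. min (D n x) L) \<longlonglongrightarrow> 0"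
        using lim
      proof eventually_elim
        case (elim x)
        have "(\<lambda>n. min (D n x) L) \<longlonglongrightarrow> min \<bar>\<psi> x - \<psi> x\<bar> L"
          unfolding D_def by (intro tendsto_intros elim)
        then show ?case using L by simp
      qed
      show "AE x in M. norm (min (D n x) L) \<le> L" for n
        using L by (auto simp: D_def)
    qed auto
    then have "\<forall>\<^sub>F n in sequentially. (\<integral>x. min (D n x) L \<partial>M) < e / 2"
      using \<open>e > 0\<close> by (intro order_tendstoD) auto
    then show "\<forall>\<^sub>F n in sequentially. \<bar>(\<integral>x. \<phi> n x \<partial>M) - (\<integral>x. \<psi> x \<partial>M)\<bar> < e"
    proof eventually_elim
      case (elim n)
      have imin: "integrable M (\<lambda>x. min (D n x) L)"
        by (rule integrable_const_bound[where B=L]) (use L in \<open>auto simp: D_def\<close>)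
      have iD: "integrable M (D n)"
        unfolding D_def by (intro integrable_abs Bochner_Integration.integrable_diff \<phi>2 \<psi>2)
      have "\<bar>(\<integral>x. \<phi> n x \<partial>M) - (\<integral>x. \<psi> x \<partial>M)\<bar> = \<bar>\<integral>x. \<phi> n x - \<psi> x \<partial>M\<bar>"
        by (simp add: \<phi>2 \<psi>2)
      also have "\<dots> \<le> (\<integral>x. D n x \<partial>M)"
        unfolding D_def by (rule integral_abs_bound)
      also have "\<dots> \<le> (\<integral>x. min (D n x) L + (D n x)\<^sup>2 / L \<partial>M)"
        using min_le by (intro integral_mono iD Bochner_Integration.integrable_add imin) (auto simp: D2)
      also have "\<dots> = (\<integral>x. min (D n x) L \<partial>M) + (\<integral>x. (D n x)\<^sup>2 \<partial>M) / L"
        using imin D2 by simp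
      also have "(\<integral>x. (D n x)\<^sup>2 \<partial>M) / L \<le> 4 * C / L"
        using D2 L by (intro divide_right_mono) auto
      finally show ?case using elim L by linarith
    qed
  qed (auto intro!: always_eventually less_le_trans[OF _ abs_ge_zero])
  then have "(\<lambda>n. (\<integral>x. \<phi> n x \<partial>M) - (\<integral>x. \<psi> x \<partial>M)) \<longlonglongrightarrow> 0"
    by (rule tendsto_rabs_zero_cancel)
  then show ?thesis by (simp add: LIM_zero_iff)
qed

text \<open>Freezing the partial sums at their exit from \<open>]-L, L[\<close> turns the maximal inequality into Chebyshev's.\<close>

primrec stopped_sum :: "real \<Rightarrow> (nat \<Rightarrow> 'a \<Rightarrow> real) \<Rightarrow> nat \<Rightarrow> 'a \<Rightarrow> real" where
  "stopped_sum L d 0 x = 0"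
| "stopped_sum L d (Suc n) x =
     stopped_sum L d n x + (if \<bar>stopped_sum L d n x\<bar> < L then d n x else 0)"

lemma stopped_sum_eq:
  assumes "\<And>k. k < n \<Longrightarrow> \<bar>\<Sum>i<k. d i x\<bar> < L"
  shows "stopped_sum L d n x = (\<Sum>i<n. d i x)"
  using assms by (induction n) auto

text \<open>At the first exit nothing has been frozen yet, so the stopped sum still agrees with the
  plain one.\<close>

lemma stopped_sum_exits:
  assumes "L \<le> \<bar>\<Sum>i<n. d i x\<bar>"
  shows "\<exists>n. L \<le> \<bar>stopped_sum L d n x\<bar>"
proof -
  define m where "m = (LEAST n. L \<le> \<bar>\<Sum>i<n. d i x\<bar>)"
  have "L \<le> \<bar>\<Sum>i<m. d i x\<bar>" unfolding m_def using assms by (rule LeastI)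
  moreover have "stopped_sum L d m x = (\<Sum>i<m. d i x)"
  proof (rule stopped_sum_eq)
    fix k assume "k < m"
    then show "\<bar>\<Sum>i<k. d i x\<bar> < L"
      using not_less_Least[of k "\<lambda>n. L \<le> \<bar>\<Sum>i<n. d i x\<bar>"] by (simp add: m_def not_le)
  qed
  ultimately show ?thesis by metis
qed

text \<open>The increments are orthogonal to the past, so the second moment of the stopped sum is at
  most the sum of the \<open>c n\<close>. A path outside the interval is frozen, so the exit events
  increase with time and Chebyshev's bound passes to their union.\<close>

lemma (in prob_space) kolmogorov_maximal_inequality:
  fixes d :: "nat \<Rightarrow> 'a \<Rightarrow> real" and F :: "nat \<Rightarrow> 'a measure"
  assumes sub: "\<And>n. subalgebra M (F n)"
    and adapted: "\<And>k n. k < n \<Longrightarrow> d k \<in> borel_measurable (F n)"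
    and mart: "\<And>n A. A \<in> sets (F n) \<Longrightarrow> (\<integral>x. indicator A x * d n x \<partial>M) = 0"
    and sq: "\<And>n. integrable M (\<lambda>x. (d n x)\<^sup>2)"
    and c: "\<And>n. (\<integral>x. (d n x)\<^sup>2 \<partial>M) \<le> c n" "summable c"
    and L: "L > 0"
  shows "prob {x \<in> space M. \<exists>n. L \<le> \<bar>\<Sum>k<n. d k x\<bar>} \<le> suminf c / L\<^sup>2"
proof -
  have meas[measurable]: "d n \<in> borel_measurable M" for n
    using measurable_from_subalg[OF sub adapted[of n "Suc n"]] by simp
  have int: "integrable M (d n)" for n
    using sq by (rule square_integrable_imp_integrable[OF meas])
  have c0: "c n \<ge> 0" for n
    by (rule order_trans[OF _ c(1)]) simp
  define T where "T = stopped_sum L d"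
  have TF: "T n \<in> borel_measurable (F m)" if "n \<le> m" for n m
    using that
  proof (induction n)
    case 0
    then show ?case by (simp add: T_def)
  next
    case (Suc n)
    then have [measurable]: "T n \<in> borel_measurable (F m)" "d n \<in> borel_measurable (F m)"
      using adapted[of n m] by auto
    have "(\<lambda>x. T n x + (if \<bar>T n x\<bar> < L then d n x else 0)) \<in> borel_measurable (F m)"
      by measurable
    then show ?case by (simp add: T_def)
  qed
  have [measurable]: "T n \<in> borel_measurable M" for n
    using measurable_from_subalg[OF sub TF[OF order_refl]] .
  \<comment> \<open>The stopped sum while still active. It is bounded by \<open>L\<close>, so its
    product with \<open>d n\<close> is integrable and conditioning applies.\<close>
  define u where "u n x = (if \<bar>T n x\<bar> < L then T n x else 0)" for n x
  have uF[measurable]: "u n \<in> borel_measurable (F n)" for n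
    using TF[OF order_refl] unfolding u_def by measurable
  have uM[measurable]: "u n \<in> borel_measurable M" for n
    using measurable_from_subalg[OF sub uF] .
  have ud: "integrable M (\<lambda>x. u n x * d n x)" for n
    by (rule Bochner_Integration.integrable_bound[where f="\<lambda>x. L * d n x"])
       (use L in \<open>auto simp: int u_def abs_mult intro!: AE_I2 mult_mono\<close>)
  have ud0: "(\<integral>x. u n x * d n x \<partial>M) = 0" for n
  proof -
    interpret finite_measure_subalgebra M "F n"
      by unfold_locales (rule sub)
    \<comment> \<open>\<open>mart\<close> says that \<open>d n\<close> has zero conditional
      expectation, which extends the orthogonality from indicators to the multiplier
      \<open>u n\<close>.\<close>
    have "AE x in M. real_cond_exp M (F n) (d n) x = 0"
      by (rule real_cond_exp_charact)
         (use mart in \<open>auto simp: int set_lebesgue_integral_def\<close>)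
    then have "(\<integral>x. u n x * real_cond_exp M (F n) (d n) x \<partial>M) = (\<integral>x. 0 \<partial>M)"
      by (intro integral_cong_AE) auto
    then show ?thesis using real_cond_exp_intg(2)[OF ud uF meas] by simp
  qed
  define v where "v n x = (if \<bar>T n x\<bar> < L then d n x else 0)" for n x
  have v: "integrable M (\<lambda>x. (v n x)\<^sup>2)" "(\<integral>x. (v n x)\<^sup>2 \<partial>M) \<le> c n" for n
  proof -
    show i: "integrable M (\<lambda>x. (v n x)\<^sup>2)"
      by (rule Bochner_Integration.integrable_bound[OF sq[of n]]) (auto simp: v_def)
    have "(\<integral>x. (v n x)\<^sup>2 \<partial>M) \<le> (\<integral>x. (d n x)\<^sup>2 \<partial>M)"
      by (intro integral_mono i sq) (auto simp: v_def)
    with c(1)[of n] show "(\<integral>x. (v n x)\<^sup>2 \<partial>M) \<le> c n" by simp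
  qed
  have step: "(T (Suc n) x)\<^sup>2 = (T n x)\<^sup>2 + 2 * (u n x * d n x) + (v n x)\<^sup>2" for n x
    by (simp add: T_def u_def v_def power2_eq_square algebra_simps)
  have T2: "integrable M (\<lambda>x. (T n x)\<^sup>2) \<and> (\<integral>x. (T n x)\<^sup>2 \<partial>M) \<le> (\<Sum>k<n. c k)" for n
  proof (induction n)
    case 0
    then show ?case by (simp add: T_def)
  next
    case (Suc n)
    then show ?case unfolding step using v[of n] ud[of n] ud0[of n] by simp
  qed
  define A where "A n = {x \<in> space M. L \<le> \<bar>T n x\<bar>}" for n
  have [measurable]: "A n \<in> sets M" for n unfolding A_def by measurable
  have "prob (A n) \<le> suminf c / L\<^sup>2" for n
  proof -
    have "A n = {x \<in> space M. L\<^sup>2 \<le> (T n x)\<^sup>2}"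
      using L by (auto simp: A_def abs_le_square_iff[symmetric])
    also have "prob \<dots> \<le> (\<integral>x. (T n x)\<^sup>2 \<partial>M) / L\<^sup>2"
      using T2[of n] L by (intro integral_Markov_inequality_measure[where A="space M"]) auto
    also have "\<dots> \<le> suminf c / L\<^sup>2"
      using T2[of n] sum_le_suminf[OF c(2), of "{..<n}"] c0
      by (intro divide_right_mono) auto
    finally show ?thesis .
  qed
  moreover have "incseq A"
    by (rule incseq_SucI) (auto simp: A_def T_def)
  then have "(\<lambda>n. prob (A n)) \<longlonglongrightarrow> prob (\<Union>n. A n)"
    by (intro finite_Lim_measure_incseq) auto
  ultimately have "prob (\<Union>n. A n) \<le> suminf c / L\<^sup>2"
    by (intro LIMSEQ_le_const2) auto
  moreover have "prob {x \<in> space M. \<exists>n. L \<le> \<bar>\<Sum>k<n. d k x\<bar>} \<le> prob (\<Union>n. A n)"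
  proof (rule finite_measure_mono)
    show "{x \<in> space M. \<exists>n. L \<le> \<bar>\<Sum>k<n. d k x\<bar>} \<subseteq> (\<Union>n. A n)"
    proof clarify
      fix x n assume "x \<in> space M" "L \<le> \<bar>\<Sum>k<n. d k x\<bar>"
      with stopped_sum_exits[where L=L and d=d and x=x and n=n] show "x \<in> (\<Union>n. A n)" by (auto simp: A_def T_def)
    qed
  qed auto
  ultimately show ?thesis by simp
qed

text \<open>A path with unbounded sums exceeds every level, and the bound of the maximal inequality
  tends to 0 as the level grows.\<close>

lemma (in prob_space) AE_bounded_martingale:
  fixes d :: "nat \<Rightarrow> 'a \<Rightarrow> real" and F :: "nat \<Rightarrow> 'a measure"
  assumes sub: "\<And>n. subalgebra M (F n)"
    and adapted: "\<And>k n. k < n \<Longrightarrow> d k \<in> borel_measurable (F n)"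
    and mart: "\<And>n A. A \<in> sets (F n) \<Longrightarrow> (\<integral>x. indicator A x * d n x \<partial>M) = 0"
    and sq: "\<And>n. integrable M (\<lambda>x. (d n x)\<^sup>2)"
    and c: "\<And>n. (\<integral>x. (d n x)\<^sup>2 \<partial>M) \<le> c n" "summable c"
  shows "AE x in M. \<exists>B. \<forall>n. \<bar>\<Sum>k<n. d k x\<bar> \<le> B"
proof -
  have meas[measurable]: "d n \<in> borel_measurable M" for n
    using measurable_from_subalg[OF sub adapted[of n "Suc n"]] by simp
  define E where "E L = {x \<in> space M. \<exists>n. real (Suc L) \<le> \<bar>\<Sum>k<n. d k x\<bar>}" for L
  have [measurable]: "E L \<in> sets M" for L unfolding E_def by measurable
  have c0: "suminf c \<ge> 0"
    by (rule suminf_nonneg[OF c(2)]) (rule order_trans[OF _ c(1)], simp)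
  have "prob (\<Inter>L. E L) = 0"
  proof (rule antisym)
    have le: "prob (\<Inter>L. E L) \<le> suminf c * inverse (real (Suc L))" for L
    proof -
      have "prob (\<Inter>L. E L) \<le> prob (E L)"
        by (intro finite_measure_mono) auto
      also have "\<dots> \<le> suminf c / (real (Suc L))\<^sup>2"
        unfolding E_def by (rule kolmogorov_maximal_inequality[OF assms]) auto
      also have "\<dots> \<le> suminf c / (real (Suc L))"
        using c0 by (intro divide_left_mono) (auto simp: power2_eq_square)
      finally show ?thesis by (simp add: divide_inverse)
    qed
    have "(\<lambda>L. suminf c * inverse (real (Suc L))) \<longlonglongrightarrow> suminf c * 0"
      by (intro tendsto_intros LIMSEQ_inverse_real_of_nat)
    from LIMSEQ_le_const[OF this, of "prob (\<Inter>L. E L)"] le show "prob (\<Inter>L. E L) \<le> 0" by auto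
  qed simp
  then have "AE x in M. x \<notin> (\<Inter>L. E L)"
    by (intro AE_not_in) (auto simp: null_sets_def emeasure_eq_measure)
  moreover have "AE x in M. x \<in> space M" by (rule AE_space)
  ultimately show ?thesis
  proof eventually_elim
    case (elim x)
    then obtain L where "x \<notin> E L" by auto
    with elim(2) show ?case
      by (intro exI[of _ "real (Suc L)"]) (auto simp: E_def not_le intro: less_imp_le)
  qed
qed

section \<open>Integrating out an independent variable\<close>

lemma (in prob_space) product_law_nn_integral:
  assumes [measurable]: "random_variable S Z" "random_variable T W"
    and eq: "distr M S Z \<Otimes>\<^sub>M distr M T W = distr M (S \<Otimes>\<^sub>M T) (\<lambda>x. (Z x, W x))"
    and f[measurable]: "f \<in> borel_measurable (S \<Otimes>\<^sub>M T)"
  shows "(\<integral>\<^sup>+s. f (Z s, W s) \<partial>M) = (\<integral>\<^sup>+s. (\<integral>\<^sup>+t. f (Z s, t) \<partial>distr M T W) \<partial>M)"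
proof -
  interpret W: prob_space "distr M T W" by (rule prob_space_distr) measurable
  have "(\<integral>\<^sup>+s. f (Z s, W s) \<partial>M) = (\<integral>\<^sup>+x. f x \<partial>(distr M S Z \<Otimes>\<^sub>M distr M T W))"
    unfolding eq by (subst nn_integral_distr) auto
  also have "\<dots> = (\<integral>\<^sup>+z. (\<integral>\<^sup>+t. f (z, t) \<partial>distr M T W) \<partial>distr M S Z)"
    by (rule W.nn_integral_fst[symmetric]) simp
  also have "\<dots> = (\<integral>\<^sup>+s. (\<integral>\<^sup>+t. f (Z s, t) \<partial>distr M T W) \<partial>M)"
    by (subst nn_integral_distr) auto
  finally show ?thesis .
qed

text \<open>Fubini's theorem on the factorised joint law: independence lets \<open>W\<close> be
  averaged with \<open>Z\<close> frozen. This does the work of conditioning on the past.\<close>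

lemma (in prob_space) product_law_integral:
  fixes f :: "_ \<Rightarrow> real"
  assumes [measurable]: "random_variable S Z" "random_variable T W"
    and eq: "distr M S Z \<Otimes>\<^sub>M distr M T W = distr M (S \<Otimes>\<^sub>M T) (\<lambda>x. (Z x, W x))"
    and f[measurable]: "f \<in> borel_measurable (S \<Otimes>\<^sub>M T)"
    and int: "integrable M (\<lambda>s. f (Z s, W s))"
  shows "(\<integral>s. f (Z s, W s) \<partial>M) = (\<integral>s. (\<integral>t. f (Z s, t) \<partial>distr M T W) \<partial>M)"
proof -
  interpret W: prob_space "distr M T W" by (rule prob_space_distr) measurable
  interpret Z: prob_space "distr M S Z" by (rule prob_space_distr) measurable
  interpret P: pair_prob_space "distr M S Z" "distr M T W" ..
  have "(\<integral>s. f (Z s, W s) \<partial>M) = (\<integral>x. f x \<partial>(distr M S Z \<Otimes>\<^sub>M distr M T W))"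
    unfolding eq by (subst integral_distr) auto
  also have "\<dots> = (\<integral>z. (\<integral>t. f (z, t) \<partial>distr M T W) \<partial>distr M S Z)"
    using int by (intro P.integral_fst'[symmetric]) (simp add: eq integrable_distr_eq)
  also have "\<dots> = (\<integral>s. (\<integral>t. f (Z s, t) \<partial>distr M T W) \<partial>M)"
    by (subst integral_distr) auto
  finally show ?thesis .
qed

section \<open>The mean gradient\<close>

text \<open>Mean value theorem on each subinterval; uniform continuity of \<open>\<phi>'\<close>
  compares the slope found there with the one at the left endpoint. Finite sums are used because
  they can be averaged over the samples term by term.\<close>

lemma riemann_sums_converge:
  fixes \<phi> \<phi>' :: "real \<Rightarrow> real"
  assumes der: "\<And>t. t \<in> {0..1} \<Longrightarrow> (\<phi> has_real_derivative \<phi>' t) (at t within {0..1})"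
    and cont: "continuous_on {0..1} \<phi>'"
  shows "(\<lambda>k. \<Sum>j<Suc k. \<phi>' (j / Suc k) / Suc k) \<longlonglongrightarrow> \<phi> 1 - \<phi> 0"
proof (rule LIMSEQ_I)
  fix e :: real assume "e > 0"
  have "uniformly_continuous_on {0..1} \<phi>'"
    by (rule compact_uniformly_continuous[OF cont]) simp
  then obtain d where d: "d > 0"
    "\<And>a b. \<lbrakk>a \<in> {0..1}; b \<in> {0..1}; dist b a < d\<rbrakk> \<Longrightarrow> dist (\<phi>' b) (\<phi>' a) < e / 2"
    using \<open>e > 0\<close> unfolding uniformly_continuous_on_def by (meson half_gt_zero)
  have step: "\<bar>\<phi>' a * (b - a) - (\<phi> b - \<phi> a)\<bar> \<le> e / 2 * (b - a)"
    if ab: "0 \<le> a" "a < b" "b \<le> 1" "b - a < d" for a b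
  proof -
    have "\<exists>x\<in>{a<..<b}. \<phi> b - \<phi> a = \<phi>' x * (b - a)"
    proof (rule mvt_simple[where f'="\<lambda>x h. \<phi>' x * h", OF ab(2)])
      show "(\<phi> has_derivative (\<lambda>h. \<phi>' x * h)) (at x within {a..b})" if "a \<le> x" "x \<le> b" for x
        using has_field_derivative_subset[OF der[of x], of "{a..b}"] ab that
        by (auto simp: has_field_derivative_def)
    qed
    then obtain x where x: "x \<in> {a<..<b}" "\<phi> b - \<phi> a = \<phi>' x * (b - a)" by blast
    have "\<bar>\<phi>' a - \<phi>' x\<bar> \<le> e / 2"
      using d(2)[of x a] x(1) ab by (simp add: dist_real_def)
    then have "\<bar>\<phi>' a - \<phi>' x\<bar> * (b - a) \<le> e / 2 * (b - a)"
      using ab by (intro mult_right_mono) auto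
    also have "\<bar>\<phi>' a - \<phi>' x\<bar> * (b - a) = \<bar>\<phi>' a * (b - a) - (\<phi> b - \<phi> a)\<bar>"
      using ab unfolding x(2) by (simp add: abs_mult flip: left_diff_distrib)
    finally show ?thesis .
  qed
  obtain N :: nat where N: "N > 0" "inverse (real N) < d"
    using real_arch_inverse[THEN iffD1, OF d(1)] by auto
  show "\<exists>N. \<forall>k\<ge>N. norm ((\<Sum>j<Suc k. \<phi>' (j / Suc k) / Suc k) - (\<phi> 1 - \<phi> 0)) < e"
  proof (intro exI[of _ N] allI impI)
    fix k assume k: "N \<le> k"
    define n where "n = Suc k"
    have n: "n > 0" by (simp add: n_def)
    have "1 / real n \<le> inverse (real N)"
      using k N n by (auto simp: n_def inverse_eq_divide intro!: divide_left_mono)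
    with N have nd: "1 / real n < d" by simp
    have tel: "\<phi> 1 - \<phi> 0 = (\<Sum>j<n. \<phi> (Suc j / n) - \<phi> (j / n))"
      using sum_lessThan_telescope[of "\<lambda>j. \<phi> (real j / real n)" n] n by simp
    have "\<bar>(\<Sum>j<n. \<phi>' (j / n) / n) - (\<phi> 1 - \<phi> 0)\<bar>
          = \<bar>\<Sum>j<n. \<phi>' (j / n) / n - (\<phi> (Suc j / n) - \<phi> (j / n))\<bar>"
      unfolding tel sum_subtractf ..
    also have "\<dots> \<le> (\<Sum>j<n. \<bar>\<phi>' (j / n) / n - (\<phi> (Suc j / n) - \<phi> (j / n))\<bar>)"
      by (rule sum_abs)
    also have "\<dots> \<le> (\<Sum>j<n. e / 2 / n)"
    proof (rule sum_mono)
      fix j assume "j \<in> {..<n}"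
      then have j: "real (Suc j) \<le> real n" by simp
      have eq: "real (Suc j) / n - real j / n = 1 / n" by (simp add: diff_divide_distrib[symmetric])
      have "\<bar>\<phi>' (j / n) * (Suc j / n - j / n) - (\<phi> (Suc j / n) - \<phi> (j / n))\<bar>
            \<le> e / 2 * (Suc j / n - j / n)"
      proof (rule step)
        show "real j / n < Suc j / n" using n by (intro divide_strict_right_mono) auto
        show "Suc j / n \<le> (1::real)" using j n by simp
        show "real (Suc j) / n - real j / n < d" unfolding eq by (rule nd)
      qed simp
      then show "\<bar>\<phi>' (j / n) / n - (\<phi> (Suc j / n) - \<phi> (j / n))\<bar> \<le> e / 2 / n"
        unfolding eq by simp
    qed
    also have "\<dots> = e / 2" using n by simp
    finally show "norm ((\<Sum>j<Suc k. \<phi>' (j / Suc k) / Suc k) - (\<phi> 1 - \<phi> 0)) < e"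
      using \<open>e > 0\<close> by (simp only: n_def[symmetric] real_norm_def)
  qed
qed

locale gradient_oracle = prob_space M for M :: "'w measure" +
  fixes X :: "'v::real_normed_vector set" and G :: "'v \<Rightarrow> 'w \<Rightarrow> 'v \<Rightarrow>\<^sub>L real" and V :: real
  assumes fin_dim: "finite_dimensional TYPE('v)"
    and compact_X: "compact X" and convex_X: "convex X"
    and G_meas: "\<And>x. x \<in> X \<Longrightarrow> G x \<in> borel_measurable M"
    and G_cont: "\<And>\<omega>. \<omega> \<in> space M \<Longrightarrow> continuous_on X (\<lambda>x. G x \<omega>)"
    and V: "V \<ge> 0"
    and G_sq: "\<And>x. x \<in> X \<Longrightarrow> (\<integral>\<^sup>+\<omega>. ennreal ((norm (G x \<omega>))\<^sup>2) \<partial>M) \<le> ennreal (V\<^sup>2)"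
begin

lemma G_apply_measurable:
  "x \<in> X \<Longrightarrow> (\<lambda>\<omega>. blinfun_apply (G x \<omega>) u) \<in> borel_measurable M"
  by (intro borel_measurable_blinfun_apply G_meas)

lemma G_apply_sq:
  assumes "x \<in> X"
  shows "(\<integral>\<^sup>+\<omega>. ennreal ((blinfun_apply (G x \<omega>) u)\<^sup>2) \<partial>M) \<le> ennreal (V\<^sup>2 * (norm u)\<^sup>2)"
proof -
  have "(\<integral>\<^sup>+\<omega>. ennreal ((blinfun_apply (G x \<omega>) u)\<^sup>2) \<partial>M)
        \<le> (\<integral>\<^sup>+\<omega>. ennreal ((norm u)\<^sup>2) * ennreal ((norm (G x \<omega>))\<^sup>2) \<partial>M)"
  proof (rule nn_integral_mono)
    fix \<omega>
    have "(blinfun_apply (G x \<omega>) u)\<^sup>2 \<le> (norm (G x \<omega>) * norm u)\<^sup>2"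
      using norm_blinfun[of "G x \<omega>" u] by (simp add: abs_le_square_iff[symmetric])
    then show "ennreal ((blinfun_apply (G x \<omega>) u)\<^sup>2)
          \<le> ennreal ((norm u)\<^sup>2) * ennreal ((norm (G x \<omega>))\<^sup>2)"
      by (simp add: ennreal_mult'[symmetric] power_mult_distrib mult.commute)
  qed
  also have "\<dots> = ennreal ((norm u)\<^sup>2) * (\<integral>\<^sup>+\<omega>. ennreal ((norm (G x \<omega>))\<^sup>2) \<partial>M)"
    using measurable_compose[OF G_meas[OF assms] borel_measurable_continuous_onI[OF continuous_on_norm_id]]
    by (intro nn_integral_cmult measurable_compose[OF _ measurable_ennreal] borel_measurable_power)
  also have "\<dots> \<le> ennreal ((norm u)\<^sup>2) * ennreal (V\<^sup>2)"
    by (intro mult_left_mono G_sq assms) auto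
  finally show ?thesis by (simp add: ennreal_mult'[symmetric] mult.commute)
qed

lemma G_apply_moments:
  assumes "x \<in> X"
  shows "integrable M (\<lambda>\<omega>. (blinfun_apply (G x \<omega>) u)\<^sup>2)"
    and "(\<integral>\<omega>. (blinfun_apply (G x \<omega>) u)\<^sup>2 \<partial>M) \<le> V\<^sup>2 * (norm u)\<^sup>2"
    and "integrable M (\<lambda>\<omega>. blinfun_apply (G x \<omega>) u)"
  using second_moment_bound[OF G_apply_measurable[OF assms] _ G_apply_sq[OF assms]] by simp_all

text \<open>The mean gradient in the weak sense. On \<open>X\<close> such a functional exists and is
  unique, being determined by its values; outside \<open>X\<close> existence is not guaranteed and
  nothing is claimed.\<close>

definition grad :: "'v \<Rightarrow> 'v \<Rightarrow>\<^sub>L real" where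
  "grad x = (SOME g. \<forall>u. blinfun_apply g u = (\<integral>\<omega>. blinfun_apply (G x \<omega>) u \<partial>M))"

lemma grad_apply:
  assumes "x \<in> X"
  shows "blinfun_apply (grad x) u = (\<integral>\<omega>. blinfun_apply (G x \<omega>) u \<partial>M)"
  using someI_ex[OF blinfun_mean_exists[OF fin_dim G_apply_moments(3)[OF assms]]]
  unfolding grad_def by blast

text \<open>In each direction \<open>u\<close> the second-moment bound lets the limit pass under the
  mean; finitely many directions then control the dual norm.\<close>

lemma continuous_on_grad: "continuous_on X grad"
proof (unfold continuous_on_sequentially comp_def, intro allI ballI impI, elim conjE)
  fix x :: "nat \<Rightarrow> 'v" and a
  assume a: "a \<in> X" and x: "\<forall>n. x n \<in> X" "x \<longlonglongrightarrow> a"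
  have lim: "(\<lambda>n. blinfun_apply (grad (x n)) u) \<longlonglongrightarrow> blinfun_apply (grad a) u" for u
    unfolding grad_apply[OF a] grad_apply[OF x(1)[rule_format]]
  proof (rule L2_bounded_convergence[where C="V\<^sup>2 * (norm u)\<^sup>2"])
    show "AE \<omega> in M. (\<lambda>n. blinfun_apply (G (x n) \<omega>) u) \<longlonglongrightarrow> blinfun_apply (G a \<omega>) u"
    proof (rule AE_I2)
      fix \<omega> assume "\<omega> \<in> space M"
      from G_cont[OF this] a x have "(\<lambda>n. G (x n) \<omega>) \<longlonglongrightarrow> G a \<omega>"
        by (auto simp: continuous_on_sequentially comp_def)
      then show "(\<lambda>n. blinfun_apply (G (x n) \<omega>) u) \<longlonglongrightarrow> blinfun_apply (G a \<omega>) u"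
        by (intro tendsto_intros)
    qed
  qed (use a x in \<open>auto intro: G_apply_measurable G_apply_sq\<close>)
  obtain n :: nat and v :: "nat \<Rightarrow> 'v" and c :: "nat \<Rightarrow> real" where
    c: "\<And>y :: 'v \<Rightarrow>\<^sub>L real. norm y \<le> (\<Sum>i<n. c i * \<bar>blinfun_apply y (v i)\<bar>)"
    using norm_blinfun_le_coordinates[OF fin_dim] by metis
  have "(\<lambda>k. \<Sum>i<n. c i * \<bar>blinfun_apply (grad (x k)) (v i) - blinfun_apply (grad a) (v i)\<bar>)
      \<longlonglongrightarrow> (\<Sum>i<n. c i * \<bar>blinfun_apply (grad a) (v i) - blinfun_apply (grad a) (v i)\<bar>)"
    by (intro tendsto_intros lim)
  then have "(\<lambda>k. \<Sum>i<n. c i * \<bar>blinfun_apply (grad (x k) - grad a) (v i)\<bar>) \<longlonglongrightarrow> 0"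
    by (simp add: blinfun.diff_left)
  then have "(\<lambda>k. grad (x k) - grad a) \<longlonglongrightarrow> 0"
    by (rule Lim_null_comparison[OF always_eventually, rotated]) (rule allI, rule c)
  then show "(\<lambda>k. grad (x k)) \<longlonglongrightarrow> grad a" by (simp add: LIM_zero_iff)
qed

text \<open>Replaces differentiation of the mean objective. For almost every sample, Riemann sums of
  \<open>G\<close> along the segment tend to the increment of \<open>F\<close>; their second moments
  are bounded uniformly, so their means converge too, and each mean is at most
  \<open>c\<close>.\<close>

lemma mean_increment_le:
  assumes xz: "x \<in> X" "z \<in> X"
    and F: "integrable M (F x)" "integrable M (F z)"
    and C1: "AE \<omega> in M. C1_gradient_on X (\<lambda>x. F x \<omega>) (\<lambda>x. G x \<omega>)"
    and c: "\<And>s. s \<in> {0..1} \<Longrightarrow> blinfun_apply (grad (x + s *\<^sub>R (z - x))) (z - x) \<le> c"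
  shows "(\<integral>\<omega>. F z \<omega> \<partial>M) - (\<integral>\<omega>. F x \<omega> \<partial>M) \<le> c"
proof -
  define d where "d = z - x"
  define p where "p s = x + s *\<^sub>R d" for s
  have p: "p s \<in> X" if "s \<in> {0..1}" for s
    using convexD_alt[OF convex_X xz, of s] that by (simp add: p_def d_def algebra_simps)
  have frac: "real j / real (Suc k) \<in> {0..1}" if "j < Suc k" for j k
    using that by (simp add: divide_le_eq_1)
  have pk: "p (real j / real (Suc k)) \<in> X" if "j < Suc k" for j k
    by (rule p[OF frac[OF that]])
  define R where "R k \<omega> = (\<Sum>j<Suc k. blinfun_apply (G (p (j / Suc k)) \<omega>) d / Suc k)" for k \<omega>
  have R_meas: "R k \<in> borel_measurable M" for k
    unfolding R_def using frac[of _ k]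
    by (intro borel_measurable_sum borel_measurable_divide G_apply_measurable p
        borel_measurable_const) simp
  have "(\<lambda>k. \<integral>\<omega>. R k \<omega> \<partial>M) \<longlonglongrightarrow> (\<integral>\<omega>. F z \<omega> - F x \<omega> \<partial>M)"
  proof (rule L2_bounded_convergence[OF R_meas, where C="V\<^sup>2 * (norm d)\<^sup>2"])
    show "AE \<omega> in M. (\<lambda>k. R k \<omega>) \<longlonglongrightarrow> F z \<omega> - F x \<omega>"
      using C1
    proof eventually_elim
      case (elim \<omega>)
      have "(\<lambda>k. R k \<omega>) \<longlonglongrightarrow> F (p 1) \<omega> - F (p 0) \<omega>"
        unfolding R_def
      proof (rule riemann_sums_converge)
        fix t :: real assume t: "t \<in> {0..1}"
        \<comment> \<open>The derivative relative to \<open>X\<close> is restricted to the segment,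
          where the chain rule along \<open>p\<close> applies even at boundary points.\<close>
        have "((\<lambda>x. F x \<omega>) has_derivative blinfun_apply (G (p t) \<omega>)) (at (p t) within p ` {0..1})"
          using elim p[OF t] p unfolding C1_gradient_on_def
          by (intro has_derivative_subset[where t="p ` {0..1}" and s=X]) auto
        moreover have "(p has_derivative (\<lambda>h. h *\<^sub>R d)) (at t within {0..1})"
          unfolding p_def by (auto intro!: derivative_eq_intros)
        ultimately have "((\<lambda>t. F (p t) \<omega>) has_derivative
            (\<lambda>h. blinfun_apply (G (p t) \<omega>) (h *\<^sub>R d))) (at t within {0..1})"
          by (rule has_derivative_in_compose[rotated])
        then show "((\<lambda>t. F (p t) \<omega>) has_real_derivative blinfun_apply (G (p t) \<omega>) d)
            (at t within {0..1})"
          by (simp add: has_field_derivative_def blinfun.scaleR_right mult_commute_abs)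
      next
        have "continuous_on {0..1} p" unfolding p_def by (intro continuous_intros)
        with elim p have "continuous_on {0..1} (\<lambda>t. G (p t) \<omega>)"
          unfolding C1_gradient_on_def
          by (intro continuous_on_compose2[of X "\<lambda>x. G x \<omega>" "{0..1}" p]) (blast, blast, blast)
        then show "continuous_on {0..1} (\<lambda>t. blinfun_apply (G (p t) \<omega>) d)"
          by (intro continuous_intros)
      qed
      then show ?case by (simp add: p_def d_def)
    qed
    show "(\<integral>\<^sup>+\<omega>. ennreal ((R k \<omega>)\<^sup>2) \<partial>M) \<le> ennreal (V\<^sup>2 * (norm d)\<^sup>2)" for k
    proof -
      \<comment> \<open>Cauchy-Schwarz on the \<open>Suc k\<close> summands makes the bound
        independent of \<open>k\<close>.\<close>
      have sq: "(R k \<omega>)\<^sup>2 \<le> (\<Sum>j<Suc k. (blinfun_apply (G (p (j / Suc k)) \<omega>) d)\<^sup>2) / Suc k" for \<omega>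
      proof -
        have "(R k \<omega>)\<^sup>2 = (\<Sum>j<Suc k. blinfun_apply (G (p (j / Suc k)) \<omega>) d)\<^sup>2 / (real (Suc k))\<^sup>2"
          unfolding R_def sum_divide_distrib[symmetric] power_divide ..
        also have "\<dots> \<le> (Suc k * (\<Sum>j<Suc k. (blinfun_apply (G (p (j / Suc k)) \<omega>) d)\<^sup>2)) / (real (Suc k))\<^sup>2"
          using sum_squared_le_sum_of_squares
            [of "\<lambda>j. blinfun_apply (G (p (real j / Suc k)) \<omega>) d" "{..<Suc k}"]
          by (intro divide_right_mono) (simp_all only: card_lessThan mult.commute zero_le_power2)
        finally show ?thesis by (simp only: power2_eq_square) simp
      qed
      have "(\<integral>\<omega>. (\<Sum>j<Suc k. (blinfun_apply (G (p (j / Suc k)) \<omega>) d)\<^sup>2) / Suc k \<partial>M)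
          = (\<Sum>j<Suc k. \<integral>\<omega>. (blinfun_apply (G (p (j / Suc k)) \<omega>) d)\<^sup>2 \<partial>M) / Suc k"
        by (subst integral_divide_zero, subst Bochner_Integration.integral_sum)
          (auto intro!: G_apply_moments(1) pk simp del: of_nat_Suc)
      also have "\<dots> \<le> (\<Sum>j<Suc k. V\<^sup>2 * (norm d)\<^sup>2) / Suc k"
        using frac[of _ k] by (intro divide_right_mono sum_mono G_apply_moments(2) p) auto
      finally have le: "(\<integral>\<omega>. (\<Sum>j<Suc k. (blinfun_apply (G (p (j / Suc k)) \<omega>) d)\<^sup>2) / Suc k \<partial>M)
          \<le> V\<^sup>2 * (norm d)\<^sup>2" by simp
      have "(\<integral>\<^sup>+\<omega>. ennreal ((R k \<omega>)\<^sup>2) \<partial>M) \<le>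
          (\<integral>\<^sup>+\<omega>. ennreal ((\<Sum>j<Suc k. (blinfun_apply (G (p (j / Suc k)) \<omega>) d)\<^sup>2) / Suc k) \<partial>M)"
        by (intro nn_integral_mono ennreal_leI sq)
      also have "\<dots> = ennreal (\<integral>\<omega>. (\<Sum>j<Suc k. (blinfun_apply (G (p (j / Suc k)) \<omega>) d)\<^sup>2) / Suc k \<partial>M)"
        by (intro nn_integral_eq_integral integrable_divide_zero Bochner_Integration.integrable_sum AE_I2)
           (auto intro!: G_apply_moments(1) pk divide_nonneg_nonneg sum_nonneg
             simp del: of_nat_Suc sum.lessThan_Suc)
      also have "\<dots> \<le> ennreal (V\<^sup>2 * (norm d)\<^sup>2)" using le by (rule ennreal_leI)
      finally show ?thesis .
    qed
  qed (use F in auto)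
  moreover have "(\<integral>\<omega>. R k \<omega> \<partial>M) \<le> c" for k
  proof -
    have "(\<integral>\<omega>. R k \<omega> \<partial>M) = (\<Sum>j<Suc k. blinfun_apply (grad (p (j / Suc k))) d / Suc k)"
      unfolding R_def
      by (subst Bochner_Integration.integral_sum)
         (auto intro!: sum.cong G_apply_moments(3) pk simp: grad_apply[OF pk]
           simp del: of_nat_Suc sum.lessThan_Suc)
    also have "\<dots> \<le> (\<Sum>j<Suc k. c / Suc k)"
      using frac[of _ k] c by (intro sum_mono divide_right_mono) (auto simp: p_def d_def)
    finally show ?thesis by simp
  qed
  ultimately have "(\<integral>\<omega>. F z \<omega> - F x \<omega> \<partial>M) \<le> c"
    by (intro LIMSEQ_le_const2) auto
  with F show ?thesis by simp
qed

text \<open>Along a short segment from \<open>p\<close> the growth of \<open>f\<close> is at most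
  the slope of \<open>grad p\<close> plus a continuity error, while sharpness bounds it from below.
  Convexity of \<open>X\<close> and homogeneity in the length of the segment extend the inequality
  to all \<open>z\<close> in \<open>X\<close>.\<close>

lemma sharp_min_grad:
  assumes F: "\<And>x. x \<in> X \<Longrightarrow> integrable M (F x)" "\<And>x. x \<in> X \<Longrightarrow> f x = (\<integral>\<omega>. F x \<omega> \<partial>M)"
    and C1: "AE \<omega> in M. C1_gradient_on X (\<lambda>x. F x \<omega>) (\<lambda>x. G x \<omega>)"
    and sharp: "sharp_min_on X f p"
  obtains \<rho> r where "\<rho> > 0" "r > 0"
    "\<And>x z. \<lbrakk>x \<in> X; norm (x - p) < r; z \<in> X\<rbrakk> \<Longrightarrow> blinfun_apply (grad x) (z - p) \<ge> \<rho> * norm (z - p)"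
proof -
  from sharp obtain \<rho> where p: "p \<in> X" and \<rho>: "\<rho> > 0"
    and ev: "\<forall>\<^sub>F x in at p within X. f x \<ge> f p + \<rho> * norm (x - p)"
    unfolding sharp_min_on_def by blast
  from ev obtain r0 where r0: "r0 > 0"
    "\<And>x. \<lbrakk>x \<in> X; x \<noteq> p; dist x p < r0\<rbrakk> \<Longrightarrow> f x \<ge> f p + \<rho> * norm (x - p)"
    unfolding eventually_at by blast
  \<comment> \<open>The tolerance \<open>\<rho> / 4\<close> is spent twice: once to reach
    \<open>3/4 * \<rho>\<close> at \<open>p\<close>, once to reach \<open>\<rho> / 2\<close> at
    nearby points.\<close>
  obtain r1 where r1: "r1 > 0"
    "\<And>x. \<lbrakk>x \<in> X; dist x p < r1\<rbrakk> \<Longrightarrow> dist (grad x) (grad p) < \<rho> / 4"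
    using continuous_on_grad p \<rho> unfolding continuous_on_iff
    by (metis zero_less_divide_iff zero_less_numeral)
  have near: "\<bar>blinfun_apply (grad x - grad p) u\<bar> \<le> \<rho> / 4 * norm u"
    if "x \<in> X" "norm (x - p) < r1" for x u
  proof -
    have "\<bar>blinfun_apply (grad x - grad p) u\<bar> \<le> norm (grad x - grad p) * norm u"
      using norm_blinfun[of "grad x - grad p" u] by simp
    also have "\<dots> \<le> \<rho> / 4 * norm u"
      using r1(2)[OF that(1)] that(2) by (intro mult_right_mono) (auto simp: dist_norm)
    finally show ?thesis .
  qed
  have at_p: "blinfun_apply (grad p) (z - p) \<ge> 3/4 * \<rho> * norm (z - p)" if z: "z \<in> X" for z
  proof (cases "z = p")
    case False
    \<comment> \<open>Shrinks \<open>z\<close> towards \<open>p\<close> until both the sharpness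
      estimate and the gradient estimate apply; the factor 2 makes the inequalities strict.\<close>
    define t where "t = min 1 (min r0 r1 / (2 * norm (z - p)))"
    have t: "t > 0" "t \<le> 1" using False r0(1) r1(1) by (auto simp: t_def)
    have "t * norm (z - p) \<le> min r0 r1 / (2 * norm (z - p)) * norm (z - p)"
      by (intro mult_right_mono) (auto simp: t_def)
    also have "\<dots> < min r0 r1" using False r0(1) r1(1) by (simp add: min_less_iff_disj)
    finally have tn: "t * norm (z - p) < r0" "t * norm (z - p) < r1" by auto
    define x where "x = p + t *\<^sub>R (z - p)"
    have x: "x \<in> X" using convexD_alt[OF convex_X p z, of t] t by (simp add: x_def algebra_simps)
    have nx: "norm (x - p) = t * norm (z - p)" using t by (simp add: x_def)
    have "f x - f p \<le> blinfun_apply (grad p) (x - p) + \<rho> / 4 * norm (x - p)"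
      unfolding F(2)[OF x] F(2)[OF p]
    proof (rule mean_increment_le[OF p x F(1)[OF p] F(1)[OF x] C1])
      fix s :: real assume s: "s \<in> {0..1}"
      have "p + s *\<^sub>R (x - p) \<in> X"
        using convexD_alt[OF convex_X p x, of s] s by (simp add: algebra_simps)
      moreover have "norm (p + s *\<^sub>R (x - p) - p) \<le> norm (x - p)"
        using s by (auto intro: mult_left_le_one_le)
      then have "norm (p + s *\<^sub>R (x - p) - p) < r1" using tn nx by simp
      ultimately show "blinfun_apply (grad (p + s *\<^sub>R (x - p))) (x - p)
          \<le> blinfun_apply (grad p) (x - p) + \<rho> / 4 * norm (x - p)"
        using near[of "p + s *\<^sub>R (x - p)" "x - p"] unfolding blinfun.diff_left by linarith
    qed
    moreover have "f x \<ge> f p + \<rho> * norm (x - p)"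
      using r0(2)[OF x] tn nx False t by (simp add: dist_norm x_def)
    ultimately have "3/4 * \<rho> * norm (x - p) \<le> blinfun_apply (grad p) (x - p)" by simp
    then have "t * (3/4 * \<rho> * norm (z - p)) \<le> t * blinfun_apply (grad p) (z - p)"
      unfolding nx by (simp add: x_def blinfun.scaleR_right mult_ac)
    with t show ?thesis by simp
  qed simp
  show thesis
  proof (rule that[of "\<rho> / 2" r1])
    fix x z assume "x \<in> X" "norm (x - p) < r1" "z \<in> X"
    with near[of x "z - p"] at_p[of z]
    show "blinfun_apply (grad x) (z - p) \<ge> \<rho> / 2 * norm (z - p)"
      using left_diff_distrib[of "3/4 * \<rho>" "\<rho> / 4" "norm (z - p)"]
      unfolding blinfun.diff_left by linarith
  qed (use \<rho> r1 in auto)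
qed

text \<open>
  \<open>G\<close> is a Caratheodory function: it is the pointwise limit of its values at the points of
  finer and finer finite nets of \<open>X\<close>.
\<close>

lemma G_joint_measurable:
  assumes Z: "Z \<in> borel_measurable S" "\<And>s. s \<in> space S \<Longrightarrow> Z s \<in> X"
    and W: "W \<in> measurable S M"
  shows "(\<lambda>s. G (Z s) (W s)) \<in> borel_measurable S"
proof (rule borel_measurable_blinfunI[OF fin_dim])
  fix u
  have "\<exists>xs. set xs \<subseteq> X \<and> X \<subseteq> (\<Union>x\<in>set xs. ball x (inverse (real (Suc k))))" for k
  proof -
    have "inverse (real (Suc k)) > 0" by simp
    from seq_compact_imp_totally_bounded
        [OF compact_X[unfolded compact_eq_seq_compact_metric], rule_format, OF this]
    obtain C where C: "finite C" "C \<subseteq> X" "X \<subseteq> (\<Union>x\<in>C. ball x (inverse (real (Suc k))))"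
      by (elim exE conjE) (rule that)
    from finite_list[OF C(1)] obtain xs where "set xs = C" ..
    with C(2,3) show ?thesis by (intro exI[of _ xs]) simp
  qed
  from choice[OF allI[OF this]] obtain xs where
    "\<forall>k. set (xs k) \<subseteq> X \<and> X \<subseteq> (\<Union>x\<in>set (xs k). ball x (inverse (real (Suc k))))" ..
  note xs = conjunct1[OF spec[OF this]] conjunct2[OF spec[OF this]]
  \<comment> \<open>The least suitable index of a net point, unlike an arbitrary choice, depends
    measurably on \<open>z\<close>.\<close>
  define P where "P k i z \<longleftrightarrow> i < length (xs k) \<and> dist (xs k ! i) z < inverse (real (Suc k))" for k i z
  define idx where "idx k z = (LEAST i. P k i z)" for k z
  have idx: "P k (idx k z) z" if "z \<in> X" for k z
  proof -
    from subsetD[OF xs(2) that, of k] obtain x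
      where x: "x \<in> set (xs k)" "dist x z < inverse (real (Suc k))"
      by (auto simp del: of_nat_Suc)
    from x(1) obtain i where "i < length (xs k)" "xs k ! i = x" unfolding in_set_conv_nth by blast
    with x(2) have "P k i z" unfolding P_def by blast
    then show ?thesis unfolding idx_def by (rule LeastI)
  qed
  have "(\<lambda>s. dist (xs k ! i) (Z s)) \<in> borel_measurable S" for k i
    by (rule measurable_compose[OF Z(1)]) (intro borel_measurable_continuous_onI continuous_intros)
  then have idx_meas: "(\<lambda>s. idx k (Z s)) \<in> measurable S (count_space UNIV)" for k
    unfolding idx_def P_def by measurable
  \<comment> \<open>The guard keeps the argument of \<open>G\<close> in \<open>X\<close> for every
    fixed index, which the measurability of each piece requires; on \<open>space S\<close> it always
    holds.\<close>
  define H where "H k s = (if idx k (Z s) < length (xs k)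
      then blinfun_apply (G (xs k ! idx k (Z s)) (W s)) u else 0)" for k s
  have "H k \<in> borel_measurable S" for k
    unfolding H_def
  proof (rule measurable_compose_countable[OF _ idx_meas])
    fix i
    show "(\<lambda>s. if i < length (xs k) then blinfun_apply (G (xs k ! i) (W s)) u else 0)
          \<in> borel_measurable S"
      using xs(1)[of k] by (cases "i < length (xs k)")
        (auto intro!: measurable_compose[OF W G_apply_measurable])
  qed
  moreover have "(\<lambda>k. H k s) \<longlonglongrightarrow> blinfun_apply (G (Z s) (W s)) u" if s: "s \<in> space S" for s
  proof -
    let ?z = "\<lambda>k. xs k ! idx k (Z s)"
    have idx': "idx k (Z s) < length (xs k)" "dist (?z k) (Z s) < inverse (real (Suc k))" for k
      using idx[OF Z(2)[OF s], of k] by (auto simp: P_def)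
    have z: "?z k \<in> X" for k using xs(1)[of k] idx'(1)[of k] by auto
    have "?z \<longlonglongrightarrow> Z s"
      by (rule tendsto_dist_iff[THEN iffD2],
          rule Lim_null_comparison[OF always_eventually LIMSEQ_inverse_real_of_nat])
         (use idx'(2) in \<open>auto intro: less_imp_le simp del: of_nat_Suc\<close>)
    with G_cont[OF measurable_space[OF W s]] z Z(2)[OF s]
    have "(\<lambda>k. G (?z k) (W s)) \<longlonglongrightarrow> G (Z s) (W s)"
      by (auto simp: continuous_on_sequentially comp_def)
    then show ?thesis using idx'(1) by (auto simp: H_def intro!: tendsto_intros)
  qed
  ultimately show "(\<lambda>s. blinfun_apply (G (Z s) (W s)) u) \<in> borel_measurable S"
    by (rule borel_measurable_LIMSEQ_real[rotated])
qed

end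

section \<open>Stochastic mirror descent\<close>

locale smd_process = gradient_oracle M X G V + mirror_setup X h K + N: prob_space N
  for M :: "'w measure" and X :: "'v::real_normed_vector set" and G V h K and N :: "'s measure" +
  fixes w :: "nat \<Rightarrow> 's \<Rightarrow> 'w" and \<gamma> :: "nat \<Rightarrow> real" and y1 :: "'v \<Rightarrow>\<^sub>L real"
  assumes iid: "iid_samples N M w" and summable_sq: "summable (\<lambda>n. (\<gamma> n)\<^sup>2)"
begin

section \<open>The filtration of the samples\<close>

abbreviation Y :: "nat \<Rightarrow> 's \<Rightarrow> 'v \<Rightarrow>\<^sub>L real" where
  "Y n s \<equiv> smd_dual Q G \<gamma> y1 w n s"

text \<open>The index \<open>n\<close> is exclusive, so that \<open>Y n\<close> belongs to the past
  at \<open>n\<close> while \<open>w n\<close> is independent of it. The pull-back of a product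
  algebra is the form in which independence of blocks of samples is available.\<close>

definition past :: "nat \<Rightarrow> 's measure" where
  "past n = vimage_algebra (space N) (\<lambda>s. \<lambda>i\<in>{..<n}. w i s) (PiM {..<n} (\<lambda>_. M))"

lemma indep: "N.indep_vars (\<lambda>_. M) w UNIV" and law: "distr N M (w n) = M"
  using iid by (auto simp: iid_samples_def)

lemma w_meas[measurable]: "w n \<in> measurable N M"
  using indep by (simp add: N.indep_vars_def2)

lemma past_map_measurable: "(\<lambda>s. \<lambda>i\<in>{..<n}. w i s) \<in> measurable N (PiM {..<n} (\<lambda>_. M))"
  by measurable

lemma sets_past: "sets (past n) = {(\<lambda>s. \<lambda>i\<in>{..<n}. w i s) -` A \<inter> space N | A. A \<in> sets (PiM {..<n} (\<lambda>_. M))}"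
  unfolding past_def
  by (rule sets_vimage_algebra2) (use measurable_space[OF past_map_measurable] in blast)

lemma space_past: "space (past n) = space N"
  by (simp add: past_def)

lemma subalgebra_past: "subalgebra N (past n)"
  unfolding subalgebra_def sets_past space_past
  using measurable_sets[OF past_map_measurable] by blast

lemma w_past: "k < n \<Longrightarrow> w k \<in> measurable (past n) M"
proof -
  assume k: "k < n"
  have "(\<lambda>s. \<lambda>i\<in>{..<n}. w i s) \<in> measurable (past n) (PiM {..<n} (\<lambda>_. M))"
    unfolding past_def
    by (rule measurable_vimage_algebra1) (use measurable_space[OF past_map_measurable] in blast)
  from measurable_compose[OF this measurable_component_singleton[of k "{..<n}"]] k
  show ?thesis by simp
qed

lemma sample_past_measurable:
  assumes "n < m" "Y n \<in> borel_measurable (past m)"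
  shows "(\<lambda>s. G (Q (Y n s)) (w n s)) \<in> borel_measurable (past m)"
  by (intro G_joint_measurable measurable_compose[OF assms(2)] w_past assms(1) Q_in
      borel_measurable_continuous_onI[OF continuous_on_Q])

lemma Y_past: "n \<le> m \<Longrightarrow> Y n \<in> borel_measurable (past m)"
proof (induction n)
  case (Suc n)
  then have Y: "Y n \<in> borel_measurable (past m)" by simp
  have G: "(\<lambda>s. G (Q (Y n s)) (w n s)) \<in> borel_measurable (past m)"
    using Suc.prems by (intro sample_past_measurable Y) simp
  show ?case
  proof (rule borel_measurable_blinfunI[OF fin_dim])
    fix u
    have [measurable]: "(\<lambda>s. blinfun_apply (Y n s) u) \<in> borel_measurable (past m)"
      by (rule borel_measurable_blinfun_apply[OF Y])
    have [measurable]: "(\<lambda>s. blinfun_apply (G (Q (Y n s)) (w n s)) u) \<in> borel_measurable (past m)"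
      by (rule borel_measurable_blinfun_apply[OF G])
    have "(\<lambda>s. blinfun_apply (Y n s) u - \<gamma> n * blinfun_apply (G (Q (Y n s)) (w n s)) u)
        \<in> borel_measurable (past m)" by measurable
    then show "(\<lambda>s. blinfun_apply (Y (Suc n) s) u) \<in> borel_measurable (past m)"
      by (simp add: blinfun.diff_left blinfun.scaleR_left)
  qed
next
  case 0
  have "Y 0 = (\<lambda>s. y1)" by (rule ext) simp
  then show ?case by simp
qed

lemma Y_measurable: "Y n \<in> borel_measurable N"
  by (rule measurable_from_subalg[OF subalgebra_past Y_past[OF order_refl]])

lemma sample_measurable: "(\<lambda>s. G (Q (Y n s)) (w n s)) \<in> borel_measurable N"
  by (rule measurable_from_subalg[OF subalgebra_past sample_past_measurable[OF lessI Y_past]]) simp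

text \<open>Disjoint blocks of an independent family are independent, here the samples before
  \<open>n\<close> and the sample \<open>n\<close>; it suffices to compare the two measures on
  rectangles.\<close>

lemma past_joint_law:
  assumes Z: "Z \<in> measurable (past n) S"
  shows "distr N S Z \<Otimes>\<^sub>M distr N M (w n) = distr N (S \<Otimes>\<^sub>M M) (\<lambda>s. (Z s, w n s))"
proof -
  let ?H = "\<lambda>J s. \<lambda>i\<in>J. w i s" and ?P = "\<lambda>J. PiM J (\<lambda>_::nat. M)"
  have ZN[measurable]: "Z \<in> measurable N S"
    by (rule measurable_from_subalg[OF subalgebra_past Z])
  have ind: "N.indep_set (sigma_sets (space N) {?H {..<n} -` A \<inter> space N | A. A \<in> sets (?P {..<n})})
      (sigma_sets (space N) {?H {n} -` A \<inter> space N | A. A \<in> sets (?P {n})})"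
    using N.indep_var_restrict[OF indep, of "{..<n}" "{n}"] by (simp add: N.indep_var_eq)
  interpret W: prob_space "distr N M (w n)" by (rule N.prob_space_distr) measurable
  interpret Z: prob_space "distr N S Z" by (rule N.prob_space_distr) measurable
  show ?thesis
  proof (rule pair_measure_eqI)
    fix A B assume AB: "A \<in> sets (distr N S Z)" "B \<in> sets (distr N M (w n))"
    then have [measurable]: "A \<in> sets S" "B \<in> sets M" by simp_all
    have "Z -` A \<inter> space N \<in> {?H {..<n} -` A \<inter> space N | A. A \<in> sets (?P {..<n})}"
      using measurable_sets[OF Z, of A] by (simp add: space_past flip: sets_past)
    moreover have "w n -` B \<inter> space N \<in> {?H {n} -` A \<inter> space N | A. A \<in> sets (?P {n})}"
    proof -
      \<comment> \<open>Block independence speaks of families indexed by \<open>{n}\<close>, so an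
        event of \<open>w n\<close> is rewritten as one of the one-element family.\<close>
      have 1: "(\<lambda>x. x n) -` B \<inter> space (?P {n}) \<in> sets (?P {n})"
        by (rule measurable_sets[OF measurable_component_singleton]) simp_all
      have 2: "?H {n} -` ((\<lambda>x. x n) -` B \<inter> space (?P {n})) \<inter> space N = w n -` B \<inter> space N"
      proof -
        have "?H {n} s \<in> space (?P {n})" if "s \<in> space N" for s
          using measurable_space[OF w_meas[of n] that] by (simp add: space_PiM)
        then show ?thesis by auto
      qed
      show ?thesis
        by (rule CollectI, rule exI[of _ "(\<lambda>x. x n) -` B \<inter> space (?P {n})"]) (simp only: 1 2 simp_thms)
    qed
    ultimately have "N.prob ((Z -` A \<inter> space N) \<inter> (w n -` B \<inter> space N))
        = N.prob (Z -` A \<inter> space N) * N.prob (w n -` B \<inter> space N)"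
      by (intro N.indep_setD[OF ind] sigma_sets.Basic)
    moreover have "(\<lambda>s. (Z s, w n s)) -` (A \<times> B) \<inter> space N
        = (Z -` A \<inter> space N) \<inter> (w n -` B \<inter> space N)" by auto
    ultimately show "emeasure (distr N S Z) A * emeasure (distr N M (w n)) B
        = emeasure (distr N (S \<Otimes>\<^sub>M M) (\<lambda>s. (Z s, w n s))) (A \<times> B)"
      by (simp add: emeasure_distr N.emeasure_eq_measure ennreal_mult')
  qed (simp_all add: W.sigma_finite_measure_axioms Z.sigma_finite_measure_axioms cong: sets_pair_measure_cong)
qed

lemma past_nn_integral:
  assumes "Z \<in> measurable (past n) S" "f \<in> borel_measurable (S \<Otimes>\<^sub>M M)"
  shows "(\<integral>\<^sup>+s. f (Z s, w n s) \<partial>N) = (\<integral>\<^sup>+s. (\<integral>\<^sup>+\<omega>. f (Z s, \<omega>) \<partial>M) \<partial>N)"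
  using N.product_law_nn_integral[OF measurable_from_subalg[OF subalgebra_past assms(1)]
      w_meas past_joint_law[OF assms(1)] assms(2)]
  by (simp add: law)

lemma past_integral:
  fixes f :: "_ \<Rightarrow> real"
  assumes "Z \<in> measurable (past n) S" "f \<in> borel_measurable (S \<Otimes>\<^sub>M M)"
    and "integrable N (\<lambda>s. f (Z s, w n s))"
  shows "(\<integral>s. f (Z s, w n s) \<partial>N) = (\<integral>s. (\<integral>\<omega>. f (Z s, \<omega>) \<partial>M) \<partial>N)"
  using N.product_law_integral[OF measurable_from_subalg[OF subalgebra_past assms(1)]
      w_meas past_joint_law[OF assms(1)] assms(2,3)]
  by (simp add: law)

lemma sample_second_moment:
  "(\<integral>\<^sup>+s. ennreal ((norm (G (Q (Y n s)) (w n s)))\<^sup>2) \<partial>N) \<le> ennreal (V\<^sup>2)"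
proof -
  have m: "(\<lambda>x. G (Q (fst x)) (snd x)) \<in> borel_measurable (borel \<Otimes>\<^sub>M M)"
    by (intro G_joint_measurable measurable_compose[OF measurable_fst] measurable_snd Q_in
        borel_measurable_continuous_onI[OF continuous_on_Q])
  have [measurable]: "(\<lambda>x. norm (G (Q (fst x)) (snd x))) \<in> borel_measurable (borel \<Otimes>\<^sub>M M)"
    by (rule measurable_compose[OF m borel_measurable_continuous_onI[OF continuous_on_norm_id]])
  have "(\<lambda>x. ennreal ((norm (G (Q (fst x)) (snd x)))\<^sup>2)) \<in> borel_measurable (borel \<Otimes>\<^sub>M M)"
    by (intro measurable_compose[OF _ measurable_ennreal] borel_measurable_power) fact
  from past_nn_integral[OF Y_past[OF order_refl] this]
  have "(\<integral>\<^sup>+s. ennreal ((norm (G (Q (Y n s)) (w n s)))\<^sup>2) \<partial>N)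
      = (\<integral>\<^sup>+s. (\<integral>\<^sup>+\<omega>. ennreal ((norm (G (Q (Y n s)) \<omega>))\<^sup>2) \<partial>M) \<partial>N)"
    by simp
  also have "\<dots> \<le> (\<integral>\<^sup>+s. ennreal (V\<^sup>2) \<partial>N)"
    by (intro nn_integral_mono G_sq Q_in)
  finally show ?thesis by (simp add: N.emeasure_space_1)
qed

text \<open>The direction may depend on the iterate: \<open>\<lambda>x. x - p\<close> gives the
  noise in the Fenchel coupling, a constant function gives one coordinate of the noise in the
  dual.\<close>

definition noise :: "('v \<Rightarrow> 'v) \<Rightarrow> nat \<Rightarrow> 's \<Rightarrow> real" where
  "noise u n s = \<gamma> n * blinfun_apply (G (Q (Y n s)) (w n s) - grad (Q (Y n s))) (u (Q (Y n s)))"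

text \<open>Given the past, iterate and direction are frozen and the fresh gradient has mean
  \<open>grad\<close>. Hence the noise is centred, and up to the squared step its variance is at
  most the second moment of the gradient along the direction.\<close>

lemma noise_martingale:
  assumes u: "continuous_on UNIV u" and D: "\<And>x. x \<in> X \<Longrightarrow> norm (u x) \<le> D"
  shows noise_past: "k < n \<Longrightarrow> noise u k \<in> borel_measurable (past n)"
    and noise_mean: "A \<in> sets (past n) \<Longrightarrow> (\<integral>s. indicator A s * noise u n s \<partial>N) = 0"
    and noise_sq: "integrable N (\<lambda>s. (noise u n s)\<^sup>2)"
    and noise_var: "(\<integral>s. (noise u n s)\<^sup>2 \<partial>N) \<le> V\<^sup>2 * D\<^sup>2 * (\<gamma> n)\<^sup>2"
    and noise_summable: "summable (\<lambda>n. V\<^sup>2 * D\<^sup>2 * (\<gamma> n)\<^sup>2)"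
proof -
  \<comment> \<open>The step size is removed, and dual state and sample are separate arguments, the
    form required by \<open>past_nn_integral\<close> and \<open>past_integral\<close>.\<close>
  define \<psi> where "\<psi> y \<omega> = blinfun_apply (G (Q y) \<omega>) (u (Q y)) - blinfun_apply (grad (Q y)) (u (Q y))" for y \<omega>
  have noise: "noise u n s = \<gamma> n * \<psi> (Y n s) (w n s)" for n s
    by (simp add: noise_def \<psi>_def blinfun.diff_left)
  have \<psi>_meas: "(\<lambda>s. \<psi> (A s) (W s)) \<in> borel_measurable S"
    if A: "A \<in> borel_measurable S" and W: "W \<in> measurable S M" for A W and S :: "'z measure"
  proof -
    have uQ: "(\<lambda>s. u (Q (A s))) \<in> borel_measurable S"
      by (intro measurable_compose[OF A] borel_measurable_continuous_onI
          continuous_on_compose2[OF u continuous_on_Q]) auto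
    have "(\<lambda>s. G (Q (A s)) (W s)) \<in> borel_measurable S"
      by (intro G_joint_measurable measurable_compose[OF A] W Q_in
          borel_measurable_continuous_onI[OF continuous_on_Q])
    moreover have "(\<lambda>s. grad (Q (A s))) \<in> borel_measurable S"
      by (intro measurable_compose[OF A] borel_measurable_continuous_onI
          continuous_on_compose2[OF continuous_on_grad continuous_on_Q]) (auto intro: Q_in)
    ultimately show ?thesis
      unfolding \<psi>_def
      by (intro borel_measurable_diff borel_measurable_blinfun_pairing[OF fin_dim _ uQ])
  qed
  show "k < n \<Longrightarrow> noise u k \<in> borel_measurable (past n)"
    unfolding noise[abs_def]
    by (intro borel_measurable_times borel_measurable_const \<psi>_meas Y_past w_past) auto
  have \<psi>_mean: "(\<integral>\<omega>. \<psi> y \<omega> \<partial>M) = 0" for y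
    by (simp add: \<psi>_def G_apply_moments(3)[OF Q_in] grad_apply[OF Q_in] prob_space)
  have \<psi>_var: "(\<integral>\<^sup>+\<omega>. ennreal ((\<psi> y \<omega>)\<^sup>2) \<partial>M) \<le> ennreal (V\<^sup>2 * D\<^sup>2)" for y
  proof -
    let ?g = "\<lambda>\<omega>. blinfun_apply (G (Q y) \<omega>) (u (Q y))"
    let ?m = "blinfun_apply (grad (Q y)) (u (Q y))"
    note mom = G_apply_moments[OF Q_in[of y], of "u (Q y)"]
    have sq: "(\<psi> y \<omega>)\<^sup>2 = (?g \<omega>)\<^sup>2 - 2 * ?m * ?g \<omega> + ?m\<^sup>2" for \<omega>
      by (simp add: \<psi>_def power2_eq_square algebra_simps)
    have int: "integrable M (\<lambda>\<omega>. (\<psi> y \<omega>)\<^sup>2)"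
      unfolding sq using mom by simp
    have "(\<integral>\<omega>. (\<psi> y \<omega>)\<^sup>2 \<partial>M) = (\<integral>\<omega>. (?g \<omega>)\<^sup>2 \<partial>M) - ?m\<^sup>2"
      unfolding sq using mom(1,3)
      by (simp add: grad_apply[OF Q_in, symmetric] prob_space power2_eq_square)
    also have "\<dots> \<le> V\<^sup>2 * (norm (u (Q y)))\<^sup>2"
      using mom(2) zero_le_power2[of ?m] by linarith
    also have "\<dots> \<le> V\<^sup>2 * D\<^sup>2"
      by (intro mult_left_mono power_mono D Q_in) auto
    finally show ?thesis
      using int by (subst nn_integral_eq_integral) (auto intro: ennreal_leI)
  qed
  have \<psi>2_meas: "(\<lambda>x. ennreal ((\<psi> (fst x) (snd x))\<^sup>2)) \<in> borel_measurable (borel \<Otimes>\<^sub>M M)"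
    by (intro measurable_compose[OF _ measurable_ennreal] borel_measurable_power \<psi>_meas
        measurable_fst measurable_snd)
  have \<psi>N: "(\<lambda>s. \<psi> (Y n s) (w n s)) \<in> borel_measurable N"
    by (intro \<psi>_meas Y_measurable w_meas)
  have "(\<integral>\<^sup>+s. ennreal ((\<psi> (Y n s) (w n s))\<^sup>2) \<partial>N)
      = (\<integral>\<^sup>+s. (\<integral>\<^sup>+\<omega>. ennreal ((\<psi> (Y n s) \<omega>)\<^sup>2) \<partial>M) \<partial>N)"
    using past_nn_integral[OF Y_past[OF order_refl] \<psi>2_meas] by simp
  also have "\<dots> \<le> (\<integral>\<^sup>+s. ennreal (V\<^sup>2 * D\<^sup>2) \<partial>N)"
    by (intro nn_integral_mono \<psi>_var)
  finally have "(\<integral>\<^sup>+s. ennreal ((\<psi> (Y n s) (w n s))\<^sup>2) \<partial>N) \<le> ennreal (V\<^sup>2 * D\<^sup>2)"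
    by (simp add: N.emeasure_space_1)
  note mom = N.second_moment_bound[OF \<psi>N _ this]
  show "integrable N (\<lambda>s. (noise u n s)\<^sup>2)"
    unfolding noise power_mult_distrib using mom(1) by simp
  have "(\<integral>s. (noise u n s)\<^sup>2 \<partial>N) = (\<gamma> n)\<^sup>2 * (\<integral>s. (\<psi> (Y n s) (w n s))\<^sup>2 \<partial>N)"
    unfolding noise power_mult_distrib by simp
  also have "\<dots> \<le> (\<gamma> n)\<^sup>2 * (V\<^sup>2 * D\<^sup>2)"
    using mom(2) by (intro mult_left_mono) auto
  finally show "(\<integral>s. (noise u n s)\<^sup>2 \<partial>N) \<le> V\<^sup>2 * D\<^sup>2 * (\<gamma> n)\<^sup>2"
    by (simp add: mult_ac)
  show "summable (\<lambda>n. V\<^sup>2 * D\<^sup>2 * (\<gamma> n)\<^sup>2)"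
    by (intro summable_mult summable_sq)
  show "(\<integral>s. indicator A s * noise u n s \<partial>N) = 0" if A: "A \<in> sets (past n)"
  proof -
    define Z where "Z s = (indicator A s :: real, Y n s)" for s
    have Z: "Z \<in> measurable (past n) (borel \<Otimes>\<^sub>M borel)"
      unfolding Z_def
      by (intro measurable_Pair borel_measurable_indicator A Y_past order_refl)
    define f where "f = (\<lambda>((a, y), \<omega>). a * (\<gamma> n * \<psi> y \<omega>))"
    have f: "f \<in> borel_measurable ((borel \<Otimes>\<^sub>M borel) \<Otimes>\<^sub>M M)"
      unfolding f_def split_beta'
      by (intro borel_measurable_times borel_measurable_const \<psi>_meas
          measurable_compose[OF measurable_fst] measurable_fst measurable_snd)
    have fZ: "f (Z s, w n s) = indicator A s * noise u n s" for s
      by (simp add: f_def Z_def noise)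
    have AN: "A \<in> sets N" using A subalgebra_past unfolding subalgebra_def by blast
    have "integrable N (noise u n)"
      unfolding noise[abs_def] using mom(3) by simp
    then have "integrable N (\<lambda>s. f (Z s, w n s))"
      unfolding fZ using integrable_mult_indicator[OF AN, of "noise u n"] by simp
    from past_integral[OF Z f this]
    have "(\<integral>s. f (Z s, w n s) \<partial>N) = (\<integral>s. (\<integral>\<omega>. f (Z s, \<omega>) \<partial>M) \<partial>N)" .
    also have "\<dots> = 0"
      by (simp add: f_def Z_def \<psi>_mean)
    finally show ?thesis by (simp add: fZ)
  qed
qed

lemma noise_maximal:
  assumes "continuous_on UNIV u" "\<And>x. x \<in> X \<Longrightarrow> norm (u x) \<le> D" "L > 0"
  shows "N.prob {s \<in> space N. \<exists>n. L \<le> \<bar>\<Sum>k<n. noise u k s\<bar>}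
          \<le> V\<^sup>2 * D\<^sup>2 * (\<Sum>n. (\<gamma> n)\<^sup>2) / L\<^sup>2"
  using N.kolmogorov_maximal_inequality[of past "noise u" "\<lambda>n. V\<^sup>2 * D\<^sup>2 * (\<gamma> n)\<^sup>2" L,
      OF subalgebra_past noise_martingale[OF assms(1,2)] assms(3)]
  unfolding suminf_mult[OF summable_sq] .

lemma noise_bounded:
  assumes "continuous_on UNIV u" "\<And>x. x \<in> X \<Longrightarrow> norm (u x) \<le> D"
  shows "AE s in N. \<exists>B. \<forall>n. \<bar>\<Sum>k<n. noise u k s\<bar> \<le> B"
  using N.AE_bounded_martingale[of past "noise u" "\<lambda>n. V\<^sup>2 * D\<^sup>2 * (\<gamma> n)\<^sup>2",
      OF subalgebra_past noise_martingale[OF assms(1,2)]] .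

text \<open>The summands are nonnegative, so the events at times \<open>n\<close> increase, and
  Markov's inequality at each \<open>n\<close> bounds their union.\<close>

lemma weighted_sq_sum_bound:
  assumes "L > 0"
  shows "N.prob {s \<in> space N. \<exists>n. L \<le> (\<Sum>k<n. (\<gamma> k)\<^sup>2 * (norm (G (Q (Y k s)) (w k s)))\<^sup>2 / (2 * K))}
    \<le> V\<^sup>2 * (\<Sum>n. (\<gamma> n)\<^sup>2) / (2 * K * L)"
proof -
  define g where "g k s = norm (G (Q (Y k s)) (w k s))" for k s
  have g[measurable]: "g k \<in> borel_measurable N" for k
    unfolding g_def
    by (rule measurable_compose[OF sample_measurable borel_measurable_continuous_onI[OF continuous_on_norm_id]])
  define R where "R n s = (\<Sum>k<n. (\<gamma> k)\<^sup>2 * (g k s)\<^sup>2 / (2 * K))" for n s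
  have R_meas[measurable]: "R n \<in> borel_measurable N" for n unfolding R_def by measurable
  note mom = N.second_moment_bound[OF g zero_le_power2 sample_second_moment[folded g_def]]
  have R_nonneg: "R n s \<ge> 0" for n s
    unfolding R_def using K by (intro sum_nonneg) auto
  have R_int: "integrable N (R n)" for n
    unfolding R_def using mom(1)
    by (intro Bochner_Integration.integrable_sum integrable_divide_zero integrable_mult_right) auto
  have R_le: "(\<integral>s. R n s \<partial>N) \<le> V\<^sup>2 * (\<Sum>n. (\<gamma> n)\<^sup>2) / (2 * K)" for n
  proof -
    have "(\<integral>s. R n s \<partial>N) = (\<Sum>k<n. (\<gamma> k)\<^sup>2 * (\<integral>s. (g k s)\<^sup>2 \<partial>N) / (2 * K))"
      unfolding R_def using mom(1) by (subst Bochner_Integration.integral_sum) auto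
    also have "\<dots> \<le> (\<Sum>k<n. (\<gamma> k)\<^sup>2 * V\<^sup>2 / (2 * K))"
      using mom(2) K by (intro sum_mono divide_right_mono mult_left_mono) auto
    also have "\<dots> = V\<^sup>2 * (\<Sum>k<n. (\<gamma> k)\<^sup>2) / (2 * K)"
      by (simp add: sum_divide_distrib sum_distrib_left mult.commute)
    also have "\<dots> \<le> V\<^sup>2 * (\<Sum>n. (\<gamma> n)\<^sup>2) / (2 * K)"
      using K by (intro divide_right_mono mult_left_mono sum_le_suminf summable_sq) auto
    finally show ?thesis .
  qed
  define A where "A n = {s \<in> space N. L \<le> R n s}" for n
  have [measurable]: "A n \<in> sets N" for n unfolding A_def by measurable
  have "N.prob (A n) \<le> V\<^sup>2 * (\<Sum>n. (\<gamma> n)\<^sup>2) / (2 * K * L)" for n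
  proof -
    have "N.prob (A n) \<le> (\<integral>s. R n s \<partial>N) / L"
      unfolding A_def using assms R_nonneg R_int
      by (intro integral_Markov_inequality_measure[where A="space N"]) auto
    also have "\<dots> \<le> V\<^sup>2 * (\<Sum>n. (\<gamma> n)\<^sup>2) / (2 * K) / L"
      using R_le assms by (intro divide_right_mono) auto
    finally show ?thesis by (simp add: mult.assoc)
  qed
  moreover have "incseq A"
    using K by (intro incseq_SucI) (auto simp: A_def R_def intro: add_increasing2)
  then have "(\<lambda>n. N.prob (A n)) \<longlonglongrightarrow> N.prob (\<Union>n. A n)"
    by (intro N.finite_Lim_measure_incseq) auto
  ultimately have "N.prob (\<Union>n. A n) \<le> V\<^sup>2 * (\<Sum>n. (\<gamma> n)\<^sup>2) / (2 * K * L)"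
    by (intro LIMSEQ_le_const2) auto
  moreover have "(\<Union>n. A n) = {s \<in> space N. \<exists>n. L \<le> R n s}" by (auto simp: A_def)
  ultimately show ?thesis by (simp add: R_def g_def)
qed

text \<open>Each coordinate is a scalar martingale with almost surely bounded sums, and finitely
  many coordinates control the norm. The bound \<open>C\<close> depends on the path.\<close>

lemma dual_noise_bounded:
  "AE s in N. \<exists>C. \<forall>n. norm (\<Sum>k<n. \<gamma> k *\<^sub>R (G (Q (Y k s)) (w k s) - grad (Q (Y k s)))) \<le> C"
proof -
  obtain n :: nat and v :: "nat \<Rightarrow> 'v" and c :: "nat \<Rightarrow> real" where
    c: "\<And>y :: 'v \<Rightarrow>\<^sub>L real. norm y \<le> (\<Sum>i<n. c i * \<bar>blinfun_apply y (v i)\<bar>)" "\<And>i. c i \<ge> 0"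
    by (rule norm_blinfun_le_coordinates[OF fin_dim]) (rule that)
  have "AE s in N. \<exists>B. \<forall>m. \<bar>\<Sum>k<m. noise (\<lambda>_. v i) k s\<bar> \<le> B" for i
    by (rule noise_bounded[where D="norm (v i)"]) (auto intro: continuous_on_const)
  then have "AE s in N. \<forall>i. \<exists>B. \<forall>m. \<bar>\<Sum>k<m. noise (\<lambda>_. v i) k s\<bar> \<le> B"
    by (simp add: AE_all_countable)
  then show ?thesis
  proof eventually_elim
    case (elim s)
    from choice[OF this] obtain B where B: "\<forall>i m. \<bar>\<Sum>k<m. noise (\<lambda>_. v i) k s\<bar> \<le> B i" ..
    let ?N = "\<lambda>m. \<Sum>k<m. \<gamma> k *\<^sub>R (G (Q (Y k s)) (w k s) - grad (Q (Y k s)))"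
    have "blinfun_apply (?N m) (v i) = (\<Sum>k<m. noise (\<lambda>_. v i) k s)" for m i
      by (simp add: noise_def blinfun.sum_left blinfun.scaleR_left)
    then have "norm (?N m) \<le> (\<Sum>i<n. c i * B i)" for m
      using B c(2) by (intro order_trans[OF c(1)] sum_mono mult_left_mono) auto
    then show ?case by blast
  qed
qed

section \<open>Probability of reaching the minimum\<close>

lemma smd_reaches_measurable:
  "{s \<in> space N. \<forall>\<^sub>F n in sequentially. Q (Y n s) = p} \<in> sets N"
proof -
  have "{s \<in> space N. Q (Y n s) = p} \<in> sets N" for n
  proof -
    have "(\<lambda>s. Q (Y n s)) \<in> borel_measurable N"
      by (rule measurable_compose[OF Y_measurable borel_measurable_continuous_onI[OF continuous_on_Q]])
    from measurable_sets[OF this, of "{p}"]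
    show ?thesis by (simp add: vimage_def Int_def conj_commute)
  qed
  then show ?thesis unfolding eventually_sequentially by measurable
qed

text \<open>Outside the bad events \<open>B1\<close> and \<open>B2\<close>,
  \<open>dual_path_reaches\<close> applies to almost every path; the union bound over
  \<open>noise_maximal\<close> and \<open>weighted_sq_sum_bound\<close> gives the constant.\<close>

lemma smd_reaches:
  assumes \<gamma>: "\<And>n. \<gamma> n > 0" "\<not> summable \<gamma>"
    and p: "p \<in> X" "Q y0 = p"
    and pos: "\<rho> > 0" "r > 0" "\<epsilon> > 0"
    and drift: "\<And>x z. \<lbrakk>x \<in> X; norm (x - p) < r; z \<in> X\<rbrakk> \<Longrightarrow>
                  blinfun_apply (grad x) (z - p) \<ge> \<rho> * norm (z - p)"
    and \<epsilon>: "6 * \<epsilon> \<le> K * r\<^sup>2" "fenchel_coupling X h p y1 < \<epsilon>"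
    and D: "\<And>x. x \<in> X \<Longrightarrow> norm (x - p) \<le> D"
  shows "N.prob {s \<in> space N. \<forall>\<^sub>F n in sequentially. Q (Y n s) = p}
    \<ge> 1 - (V\<^sup>2 * D\<^sup>2 / \<epsilon>\<^sup>2 + V\<^sup>2 / (2 * K * \<epsilon>)) * (\<Sum>n. (\<gamma> n)\<^sup>2)"
proof -
  define E where "E = {s \<in> space N. \<forall>\<^sub>F n in sequentially. Q (Y n s) = p}"
  define B1 where "B1 = {s \<in> space N. \<exists>n. \<epsilon> \<le> \<bar>\<Sum>k<n. noise (\<lambda>x. x - p) k s\<bar>}"
  define B2 where "B2 = {s \<in> space N. \<exists>n. \<epsilon> \<le>
      (\<Sum>k<n. (\<gamma> k)\<^sup>2 * (norm (G (Q (Y k s)) (w k s)))\<^sup>2 / (2 * K))}"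
  have cont: "continuous_on UNIV (\<lambda>x. x - p)" by (intro continuous_intros)
  have P1: "N.prob B1 \<le> V\<^sup>2 * D\<^sup>2 * (\<Sum>n. (\<gamma> n)\<^sup>2) / \<epsilon>\<^sup>2"
    unfolding B1_def by (rule noise_maximal[OF cont D pos(3)])
  have P2: "N.prob B2 \<le> V\<^sup>2 * (\<Sum>n. (\<gamma> n)\<^sup>2) / (2 * K * \<epsilon>)"
    unfolding B2_def by (rule weighted_sq_sum_bound[OF pos(3)])
  have [measurable]: "noise (\<lambda>x. x - p) k \<in> borel_measurable N" for k
    by (rule measurable_from_subalg[OF subalgebra_past noise_past[OF cont D lessI]])
  have [measurable]: "B1 \<in> sets N" unfolding B1_def by measurable
  have [measurable]: "(\<lambda>s. norm (G (Q (Y k s)) (w k s))) \<in> borel_measurable N" for k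
    by (rule measurable_compose[OF sample_measurable borel_measurable_continuous_onI[OF continuous_on_norm_id]])
  have [measurable]: "B2 \<in> sets N" unfolding B2_def by measurable
  have [measurable]: "E \<in> sets N" unfolding E_def by (rule smd_reaches_measurable)
  \<comment> \<open>Only almost surely, since the dual noise is bounded off a null set; the size of
    its bound does not enter the probability.\<close>
  have "AE s in N. s \<in> space N - (B1 \<union> B2) \<longrightarrow> s \<in> E"
    using dual_noise_bounded
  proof eventually_elim
    case (elim s)
    show ?case
    proof
      assume s: "s \<in> space N - (B1 \<union> B2)"
      from elim obtain C where
        C: "norm (\<Sum>k<n. \<gamma> k *\<^sub>R (G (Q (Y k s)) (w k s) - grad (Q (Y k s)))) \<le> C" for n by blast
      have "\<forall>\<^sub>F n in sequentially. Q (Y n s) = p"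
      proof (rule dual_path_reaches[where y="\<lambda>n. Y n s" and g="\<lambda>n. G (Q (Y n s)) (w n s)"
            and m=grad, OF _ \<gamma> p pos(1,2) drift \<epsilon>(1) _ _ _ C])
        show "\<bar>\<Sum>k<n. \<gamma> k * blinfun_apply (G (Q (Y k s)) (w k s) - grad (Q (Y k s))) (Q (Y k s) - p)\<bar> < \<epsilon>" for n
          using s unfolding B1_def noise_def by (auto simp: not_le)
        show "(\<Sum>k<n. (\<gamma> k)\<^sup>2 * (norm (G (Q (Y k s)) (w k s)))\<^sup>2 / (2 * K)) < \<epsilon>" for n
          using s unfolding B2_def by (auto simp: not_le)
      qed (use \<epsilon>(2) in auto)
      with s show "s \<in> E" by (simp add: E_def)
    qed
  qed
  then have "N.prob (space N - (B1 \<union> B2)) \<le> N.prob E"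
    by (intro N.finite_measure_mono_AE) auto
  moreover have "N.prob (space N - (B1 \<union> B2)) = 1 - N.prob (B1 \<union> B2)"
    by (intro N.prob_compl) measurable
  moreover have "N.prob (B1 \<union> B2) \<le> N.prob B1 + N.prob B2"
    by (intro measure_Un_le) auto
  ultimately show ?thesis
    using P1 P2 unfolding E_def by (simp add: distrib_right)
qed

end

section \<open>Passage to the given oracle and choice of the constants\<close>

lemma (in mirror_setup) smd_dual_cong:
  assumes "\<And>x k. x \<in> X \<Longrightarrow> G x (w k s) = G' x (w k s)"
  shows "smd_dual Q G \<gamma> y1 w n s = smd_dual Q G' \<gamma> y1 w n s"
  by (induction n) (simp_all add: assms Q_in)

theorem theorem6p7:
  fixes X :: "'v::real_normed_vector set"
    and M :: "'w measure" and N :: "'s measure"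
    and F :: "'v \<Rightarrow> 'w \<Rightarrow> real" and G :: "'v \<Rightarrow> 'w \<Rightarrow> 'v \<Rightarrow>\<^sub>L real"
    and f h :: "'v \<Rightarrow> real" and V :: real and xstar :: 'v
    and w :: "nat \<Rightarrow> 's \<Rightarrow> 'w"
    and Q :: "('v \<Rightarrow>\<^sub>L real) \<Rightarrow> 'v"
  assumes fin_dim: "finite_dimensional TYPE('v)"
    and X: "X \<noteq> {}" "compact X" "convex X"
    and M: "prob_space M" "complete_measure M"
    and F_int: "\<And>x. x \<in> X \<Longrightarrow> integrable M (F x)"
    and f_def: "\<And>x. x \<in> X \<Longrightarrow> f x = (\<integral>\<omega>. F x \<omega> \<partial>M)"
    and G_meas: "\<And>x. x \<in> X \<Longrightarrow> G x \<in> borel_measurable M"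
    and i: "AE \<omega> in M. C1_gradient_on X (\<lambda>x. F x \<omega>) (\<lambda>x. G x \<omega>)"
    and ii: "V \<ge> 0"
      "\<And>x. x \<in> X \<Longrightarrow> (\<integral>\<^sup>+\<omega>. ennreal ((norm (G x \<omega>))\<^sup>2) \<partial>M) \<le> ennreal (V\<^sup>2)"
    and h: "regularizer X h"
    and Q_def: "Q = mirror_map X h"
    and iii: "\<And>p y. \<lbrakk>p \<in> X; (\<lambda>n::nat. Q (y n)) \<longlonglongrightarrow> p\<rbrakk> \<Longrightarrow>
                (\<lambda>n. fenchel_coupling X h p (y n)) \<longlonglongrightarrow> 0"
    and Q_surj: "Q ` UNIV = X"
    and sharp: "sharp_min_on X f xstar"
    and N: "prob_space N" "iid_samples N M w"
  shows "\<exists>U. openin (top_of_set X) U \<and> xstar \<in> U \<and>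
    (\<forall>\<delta>>0. \<exists>\<eta>>0. \<forall>\<gamma> y1.
       (\<forall>n::nat. \<gamma> n > 0) \<and> summable (\<lambda>n. (\<gamma> n)\<^sup>2) \<and> \<not> summable \<gamma> \<and>
       (\<Sum>n. (\<gamma> n)\<^sup>2) \<le> \<eta> \<and> Q y1 \<in> U \<longrightarrow>
       measure (completion N)
         {s \<in> space N. \<forall>\<^sub>F n in sequentially. smd_primal Q G \<gamma> y1 w n s = xstar} \<ge> 1 - \<delta>)"
proof -
  obtain K where K: "K > 0" "strongly_convex_on K X h" and h_cont: "continuous_on X h"
    using h unfolding regularizer_def by blast
  interpret mirror_setup X h K
    by unfold_locales (use X K h_cont in auto)
  interpret N: prob_space N by (rule N(1))
  from AE_E[OF i] obtain N0 where
    N0: "{\<omega> \<in> space M. \<not> C1_gradient_on X (\<lambda>x. F x \<omega>) (\<lambda>x. G x \<omega>)} \<subseteq> N0"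
      "emeasure M N0 = 0" "N0 \<in> sets M" by blast
  have AE_N0: "AE \<omega> in M. \<omega> \<notin> N0"
    using N0 by (intro AE_not_in) (auto simp: null_sets_def)
  \<comment> \<open>Joint measurability of the oracle needs continuity for every sample, not just almost every one.\<close>
  define G' where "G' x \<omega> = (if \<omega> \<in> N0 then 0 else G x \<omega>)" for x \<omega>
  interpret go: gradient_oracle M X G' V
  proof (intro gradient_oracle.intro gradient_oracle_axioms.intro M(1) fin_dim X(2,3) ii(1))
    show "G' x \<in> borel_measurable M" if "x \<in> X" for x
      unfolding G'_def[abs_def]
      by (intro measurable_If_set G_meas that measurable_const) (use N0(3) in auto)
    show "continuous_on X (\<lambda>x. G' x \<omega>)" if "\<omega> \<in> space M" for \<omega>
      using that N0(1) by (cases "\<omega> \<in> N0") (auto simp: G'_def C1_gradient_on_def)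
    show "(\<integral>\<^sup>+\<omega>. ennreal ((norm (G' x \<omega>))\<^sup>2) \<partial>M) \<le> ennreal (V\<^sup>2)" if "x \<in> X" for x
    proof -
      have "(\<integral>\<^sup>+\<omega>. ennreal ((norm (G' x \<omega>))\<^sup>2) \<partial>M) \<le> (\<integral>\<^sup>+\<omega>. ennreal ((norm (G x \<omega>))\<^sup>2) \<partial>M)"
        by (intro nn_integral_mono) (simp add: G'_def)
      with ii(2)[OF that] show ?thesis by simp
    qed
  qed
  have C1: "AE \<omega> in M. C1_gradient_on X (\<lambda>x. F x \<omega>) (\<lambda>x. G' x \<omega>)"
    using i AE_N0 by eventually_elim (simp add: G'_def)
  obtain \<rho> r where \<rho>: "\<rho> > 0" and r: "r > 0"
    and drift: "\<And>x z. \<lbrakk>x \<in> X; norm (x - xstar) < r; z \<in> X\<rbrakk> \<Longrightarrow>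
        blinfun_apply (go.grad x) (z - xstar) \<ge> \<rho> * norm (z - xstar)"
    by (rule go.sharp_min_grad[OF F_int f_def C1 sharp]) (assumption, assumption, rule that)
  have xstar: "xstar \<in> X" using sharp by (simp add: sharp_min_on_def)
  have "xstar \<in> range Q" using xstar by (simp only: Q_surj)
  then obtain y0 where y0: "mirror_map X h y0 = xstar"
    unfolding Q_def by (elim imageE) (rule that, rule sym)
  \<comment> \<open>The largest energy level that \<open>smd_reaches\<close> allows for the radius
    \<open>r\<close>.\<close>
  define \<epsilon> where "\<epsilon> = K * r\<^sup>2 / 6"
  have \<epsilon>: "\<epsilon> > 0" "6 * \<epsilon> \<le> K * r\<^sup>2" using K r by (simp_all add: \<epsilon>_def)
  \<comment> \<open>The radius of the neighbourhood. It comes from \<open>\<epsilon>\<close>, hence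
    from \<open>r\<close>, before \<open>\<delta>\<close> is chosen; \<open>\<delta>\<close> enters
    only through the threshold on the steps.\<close>
  obtain r' where r': "r' > 0"
    and start: "\<And>y. norm (mirror_map X h y - xstar) < r' \<Longrightarrow> fenchel_coupling X h xstar y < \<epsilon>"
    by (rule fenchel_coupling_small_nhd[OF iii[OF xstar, unfolded Q_def] \<epsilon>(1)]) (assumption, rule that)
  obtain D where D: "\<And>x. x \<in> X \<Longrightarrow> norm (x - xstar) \<le> D"
    using compact_imp_bounded[OF X(2)] unfolding bounded_any_center[where a=xstar]
    by (auto simp: dist_norm norm_minus_commute)
  \<comment> \<open>By \<open>smd_reaches\<close> the failure probability is at most
    \<open>c\<close> times the sum of the squared steps, which leads to the threshold
    \<open>\<delta> / (c + 1)\<close>; the \<open>+ 1\<close> is for \<open>c = 0\<close>, as when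
    \<open>V = 0\<close>.\<close>
  define c where "c = V\<^sup>2 * D\<^sup>2 / \<epsilon>\<^sup>2 + V\<^sup>2 / (2 * K * \<epsilon>)"
  have c: "c \<ge> 0" using K \<epsilon> by (simp add: c_def)
  show ?thesis
  proof (intro exI[of _ "X \<inter> ball xstar r'"] conjI allI impI)
    show "openin (top_of_set X) (X \<inter> ball xstar r')"
      by (intro openin_open_Int open_ball)
    show "xstar \<in> X \<inter> ball xstar r'" using xstar r' by simp
    fix \<delta> :: real assume \<delta>: "\<delta> > 0"
    show "\<exists>\<eta>>0. \<forall>\<gamma> y1. (\<forall>n::nat. \<gamma> n > 0) \<and> summable (\<lambda>n. (\<gamma> n)\<^sup>2) \<and> \<not> summable \<gamma> \<and>
       (\<Sum>n. (\<gamma> n)\<^sup>2) \<le> \<eta> \<and> Q y1 \<in> X \<inter> ball xstar r' \<longrightarrow>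
       measure (completion N)
         {s \<in> space N. \<forall>\<^sub>F n in sequentially. smd_primal Q G \<gamma> y1 w n s = xstar} \<ge> 1 - \<delta>"
    proof (intro exI[of _ "\<delta> / (c + 1)"] conjI allI impI)
      show "\<delta> / (c + 1) > 0" using \<delta> c by simp
      fix \<gamma> :: "nat \<Rightarrow> real" and y1
      assume "(\<forall>n::nat. \<gamma> n > 0) \<and> summable (\<lambda>n. (\<gamma> n)\<^sup>2) \<and> \<not> summable \<gamma> \<and>
        (\<Sum>n. (\<gamma> n)\<^sup>2) \<le> \<delta> / (c + 1) \<and> Q y1 \<in> X \<inter> ball xstar r'"
      then have \<gamma>: "\<And>n. \<gamma> n > 0" "\<not> summable \<gamma>" and sq: "summable (\<lambda>n. (\<gamma> n)\<^sup>2)"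
        and \<eta>: "(\<Sum>n. (\<gamma> n)\<^sup>2) \<le> \<delta> / (c + 1)"
        and y1: "norm (mirror_map X h y1 - xstar) < r'"
        by (auto simp: Q_def dist_norm norm_minus_commute)
      interpret smd: smd_process M X G' V h K N w \<gamma> y1
        by unfold_locales (use N sq in auto)
      define E' where "E' = {s \<in> space N. \<forall>\<^sub>F n in sequentially.
          mirror_map X h (smd_dual (mirror_map X h) G' \<gamma> y1 w n s) = xstar}"
      define E where "E = {s \<in> space N. \<forall>\<^sub>F n in sequentially. smd_primal Q G \<gamma> y1 w n s = xstar}"
      have E': "E' \<in> sets N" unfolding E'_def by (rule smd.smd_reaches_measurable)
      have "c * (\<Sum>n. (\<gamma> n)\<^sup>2) \<le> c * (\<delta> / (c + 1))" using \<eta> c by (rule mult_left_mono)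
      also have "\<dots> \<le> \<delta>" using c \<delta> by (simp add: field_simps)
      finally have "1 - \<delta> \<le> 1 - c * (\<Sum>n. (\<gamma> n)\<^sup>2)" by simp
      also have "\<dots> \<le> measure N E'"
        unfolding E'_def c_def
        by (rule smd.smd_reaches[OF \<gamma> xstar y0 \<rho> r \<epsilon>(1) drift \<epsilon>(2) start[OF y1] D])
      finally have P: "1 - \<delta> \<le> measure N E'" .
      \<comment> \<open>Every sample has law \<open>M\<close>, so almost surely none of the
        countably many samples hits the exceptional set, and both oracles produce the same
        path.\<close>
      have "AE s in N. w n s \<notin> N0" for n
      proof (rule AE_distrD[OF smd.w_meas])
        show "AE \<omega> in distr N M (w n). \<omega> \<notin> N0" unfolding smd.law by (rule AE_N0)
      qed
      then have "AE s in N. \<forall>n. w n s \<notin> N0" by (simp add: AE_all_countable)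
      then have "AE s in N. s \<in> E' \<longleftrightarrow> s \<in> E"
      proof eventually_elim
        case (elim s)
        then have "smd_dual (mirror_map X h) G \<gamma> y1 w n s = smd_dual (mirror_map X h) G' \<gamma> y1 w n s" for n
          by (intro smd_dual_cong) (simp add: G'_def)
        then show ?case by (simp add: E_def E'_def smd_primal_def Q_def)
      qed
      then have AE: "AE s in completion N. s \<in> E' \<longleftrightarrow> s \<in> E" by (rule AE_completion)
      have E'C: "E' \<in> sets (completion N)" using E' by simp
      \<comment> \<open>\<open>E\<close> is built from the unmodified oracle and is not known to be
        measurable in \<open>N\<close>. It agrees almost everywhere with the measurable
        \<open>E'\<close>, hence is measurable in the completion with the same probability.\<close>
      have "E \<in> sets (completion N)"
        by (rule completion.in_sets_AE[OF AE E'C]) (auto simp: E_def)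
      with AE E'C have "measure (completion N) E' = measure (completion N) E"
        by (intro measure_eq_AE)
      with P E' show "measure (completion N)
         {s \<in> space N. \<forall>\<^sub>F n in sequentially. smd_primal Q G \<gamma> y1 w n s = xstar} \<ge> 1 - \<delta>"
        by (simp add: E_def)
    qed
  qed
qed

end
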